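(* Let $A$ be a finite alphabet and let $R$ be a length-preserving rational equivalence relation on $A^*$ (given by a transducer). Let $P_R$ be the prefix closure of $R$ and $S_R$ the syntactic congruence of $R$, and suppose that $S_R$ has finite index with respect to the transitive closure $P_R^+$ of $P_R$. Then one can (effectively) construct a subsequential letter-to-letter transducer whose realized function has kernel $R$.
   Context: Alphabets are finite. A finite transducer over alphabets $A,B$ is a tuple $(Q,\Delta,I,F)$ with $Q$ a finite set of states, $\Delta$ a finite set of transitions $(p,(x,y),q)$ with $p,q\in Q$, $(x,y)\in A^*\times B^*$, and $I,F\subseteq Q$ the initial and final states. It realizes the relation of all pairs $(u,v)$ such that some path from an initial to a final state has $u$ as the concatenation of its first components and $v$ as the concatenation of its second components. A relation is rational if it is realized by a finite transducer, and length-preserving if $uRv$ implies $|u|=|v|$. A transducer is letter-to-letter if all transition labels are in $A\times B$. It is sequential if all transition labels are in $A\times B^*$, there is one initial state, and for each state $p$ and letter $a\in A$ there is at most one transition from $p$ with input letter $a$. A subsequential transducer is a pair $(\mathcal T,t)$ with $\mathcal T$ a sequential transducer over $A,B$ with set of final states $F$ and $t:F\to B$ a final output function; on an input word $u$ whose run ends in a final state $q$ with output $v$, it produces $v\cdot t(q)$. It is letter-to-letter if $\mathcal T$ is. The kernel of a total function $f:A^*\to B^*$ is $\{(u,v)\mid f(u)=f(v)\}$. Syntactic congruence: $u\,S_R\,v$ iff $uw\,R\,vw$ for every $w\in A^*$. Prefix closure: $u\,P_R\,v$ iff there exist $u',v'\in A^*$ with $|u'|=|v'|$ and $uu'\,R\,vv'$.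 The transitive closure of $P_R$ is the smallest transitive relation containing $P_R$. For equivalence relations $S\subseteq T$, the index of $S$ with respect to $T$ is the supremum of the number of $S$-classes contained in a single $T$-class. *)

theory Defs
  imports Main "HOL-Library.Extended_Nat" "HOL-Library.Nat_Bijection"
begin

section \<open>Transducers and the relations they realize\<close>

text \<open>Words over an alphabet \<open>A\<close> (a finite set of letters) are the elements of \<^term>\<open>lists A\<close>.\<close>

record ('q, 'a, 'b) transducer =
  states :: "'q set"
  transitions :: "('q \<times> ('a list \<times> 'b list) \<times> 'q) set"
  initial :: "'q set"
  final :: "'q set"

definition finite_transducer :: "'a set \<Rightarrow> 'b set \<Rightarrow> ('q, 'a, 'b) transducer \<Rightarrow> bool" where
  "finite_transducer A B T \<longleftrightarrow>
     finite A \<and> finite B \<and> finite (states T) \<and> finite (transitions T) \<and>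
     transitions T \<subseteq> states T \<times> (lists A \<times> lists B) \<times> states T \<and>
     initial T \<subseteq> states T \<and> final T \<subseteq> states T"

inductive path :: "('q, 'a, 'b) transducer \<Rightarrow> 'q \<Rightarrow> 'a list \<Rightarrow> 'b list \<Rightarrow> 'q \<Rightarrow> bool"
  for T where
  path_Nil: "path T p [] [] p"
| path_Cons: "(p, (x, y), q) \<in> transitions T \<Longrightarrow> path T q u v r \<Longrightarrow> path T p (x @ u) (y @ v) r"

definition realized :: "('q, 'a, 'b) transducer \<Rightarrow> ('a list \<times> 'b list) set" where
  "realized T = {(u, v). \<exists>p \<in> initial T. \<exists>q \<in> final T. path T p u v q}"

definition length_preserving :: "('a list \<times> 'b list) set \<Rightarrow> bool" where
  "length_preserving R \<longleftrightarrow> (\<forall>(u, v) \<in> R. length u = length v)"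

definition letter_to_letter :: "('q, 'a, 'b) transducer \<Rightarrow> bool" where
  "letter_to_letter T \<longleftrightarrow> (\<forall>(p, (x, y), q) \<in> transitions T. length x = 1 \<and> length y = 1)"

definition sequential :: "('q, 'a, 'b) transducer \<Rightarrow> bool" where
  "sequential T \<longleftrightarrow>
     (\<forall>(p, (x, y), q) \<in> transitions T. length x = 1) \<and>
     (\<exists>i. initial T = {i}) \<and>
     (\<forall>p a y q y' q'. (p, ([a], y), q) \<in> transitions T \<and> (p, ([a], y'), q') \<in> transitions T
        \<longrightarrow> y = y' \<and> q = q')"

text \<open>The final output function \<open>t\<close> is only relevant on the final states.\<close>

definition subsequential_transducer ::
  "'a set \<Rightarrow> 'b set \<Rightarrow> ('q, 'a, 'b) transducer \<Rightarrow> ('q \<Rightarrow> 'b) \<Rightarrow> bool" where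
  "subsequential_transducer A B T t \<longleftrightarrow>
     finite_transducer A B T \<and> sequential T \<and> t ` final T \<subseteq> B"

definition subsequential_realized ::
  "('q, 'a, 'b) transducer \<Rightarrow> ('q \<Rightarrow> 'b) \<Rightarrow> ('a list \<times> 'b list) set" where
  "subsequential_realized T t =
     {(u, v @ [t q]) | u v q. \<exists>p \<in> initial T. q \<in> final T \<and> path T p u v q}"

text \<open>\<open>(T, t)\<close> realizes a total function on the words over \<open>A\<close>, and that function is \<open>f\<close>
  (whose values outside \<^term>\<open>lists A\<close> are irrelevant).\<close>

definition realizes_function ::
  "'a set \<Rightarrow> ('q, 'a, 'b) transducer \<Rightarrow> ('q \<Rightarrow> 'b) \<Rightarrow> ('a list \<Rightarrow> 'b list) \<Rightarrow> bool" where
  "realizes_function A T t f \<longleftrightarrow> subsequential_realized T t = {(u, f u) | u. u \<in> lists A}"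

definition kernel_on :: "'a set \<Rightarrow> ('a list \<Rightarrow> 'b list) \<Rightarrow> ('a list \<times> 'a list) set" where
  "kernel_on A f = {(u, v). u \<in> lists A \<and> v \<in> lists A \<and> f u = f v}"

section \<open>Syntactic congruence, prefix closure, index\<close>

definition syntactic_congruence ::
  "'a set \<Rightarrow> ('a list \<times> 'a list) set \<Rightarrow> ('a list \<times> 'a list) set" where
  "syntactic_congruence A R =
     {(u, v). u \<in> lists A \<and> v \<in> lists A \<and> (\<forall>w \<in> lists A. (u @ w, v @ w) \<in> R)}"

definition prefix_closure ::
  "'a set \<Rightarrow> ('a list \<times> 'a list) set \<Rightarrow> ('a list \<times> 'a list) set" where
  "prefix_closure A R =
     {(u, v). u \<in> lists A \<and> v \<in> lists A \<and>
        (\<exists>u' \<in> lists A. \<exists>v' \<in> lists A. length u' = length v' \<and> (u @ u', v @ v') \<in> R)}"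

text \<open>The index of \<open>S\<close> with respect to \<open>T\<close>, for equivalence relations \<open>S \<subseteq> T\<close> on \<open>X\<close>.
  The inner supremum is the (possibly infinite) number of \<open>S\<close>-classes contained in \<open>C\<close>;
  it ranges over finite sets since \<^const>\<open>card\<close> is 0 on infinite ones.\<close>

definition relative_index :: "'x set \<Rightarrow> ('x \<times> 'x) set \<Rightarrow> ('x \<times> 'x) set \<Rightarrow> enat" where
  "relative_index X S T =
     (SUP C \<in> X // T. SUP \<D> \<in> {\<D>. finite \<D> \<and> \<D> \<subseteq> {D \<in> X // S. D \<subseteq> C}}. enat (card \<D>))"

section \<open>Effectivity\<close>

text \<open>Kleene's partial recursive functions: \<open>computes f xs y\<close> means that the program \<open>f\<close> halts
  on the arguments \<open>xs\<close> with result \<open>y\<close>.\<close>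

datatype recfn =
    Zero
  | Succ
  | Proj nat
  | Compose recfn "recfn list"
  | PrimRec recfn recfn
  | Minimize recfn

inductive computes :: "recfn \<Rightarrow> nat list \<Rightarrow> nat \<Rightarrow> bool" where
  "computes Zero xs 0"
| "computes Succ [x] (Suc x)"
| "i < length xs \<Longrightarrow> computes (Proj i) xs (xs ! i)"
| "list_all2 (\<lambda>g y. computes g xs y) gs ys \<Longrightarrow> computes f ys z \<Longrightarrow> computes (Compose f gs) xs z"
| "computes f xs y \<Longrightarrow> computes (PrimRec f g) (0 # xs) y"
| "computes (PrimRec f g) (n # xs) y \<Longrightarrow> computes g (n # y # xs) z \<Longrightarrow>
     computes (PrimRec f g) (Suc n # xs) z"
| "computes f (n # xs) 0 \<Longrightarrow> (\<And>m. m < n \<Longrightarrow> \<exists>k. computes f (m # xs) (Suc k)) \<Longrightarrow>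
     computes (Minimize f) xs n"

text \<open>\<open>transducer_code\<close> relates a transducer, whose states and letters are named by natural numbers
  via \<open>\<kappa>\<close>, \<open>\<alpha>\<close>, \<open>\<beta>\<close> (injective on the states and on the two alphabets), to the numbers coding it;
  there are several of them, as the finite sets may be listed in any order and with repetitions.\<close>

definition lists_set :: "('x \<Rightarrow> nat) \<Rightarrow> 'x set \<Rightarrow> nat \<Rightarrow> bool" where
  "lists_set \<nu> X c \<longleftrightarrow> (\<exists>xs. set xs = X \<and> c = list_encode (map \<nu> xs))"

definition transition_code ::
  "('q \<Rightarrow> nat) \<Rightarrow> ('a \<Rightarrow> nat) \<Rightarrow> ('b \<Rightarrow> nat) \<Rightarrow> 'q \<times> ('a list \<times> 'b list) \<times> 'q \<Rightarrow> nat" where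
  "transition_code \<kappa> \<alpha> \<beta> = (\<lambda>(p, (x, y), q).
     list_encode [\<kappa> p, list_encode (map \<alpha> x), list_encode (map \<beta> y), \<kappa> q])"

definition transducer_code ::
  "('q \<Rightarrow> nat) \<Rightarrow> ('a \<Rightarrow> nat) \<Rightarrow> ('b \<Rightarrow> nat) \<Rightarrow> 'a set \<Rightarrow> 'b set \<Rightarrow> ('q, 'a, 'b) transducer \<Rightarrow>
     nat \<Rightarrow> bool" where
  "transducer_code \<kappa> \<alpha> \<beta> A B T c \<longleftrightarrow>
     inj_on \<kappa> (states T) \<and> inj_on \<alpha> A \<and> inj_on \<beta> B \<and>
     (\<exists>cA cB cQ cD cI cF.
        lists_set \<alpha> A cA \<and> lists_set \<beta> B cB \<and> lists_set \<kappa> (states T) cQ \<and>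
        lists_set (transition_code \<kappa> \<alpha> \<beta>) (transitions T) cD \<and>
        lists_set \<kappa> (initial T) cI \<and> lists_set \<kappa> (final T) cF \<and>
        c = list_encode [cA, cB, cQ, cD, cI, cF])"

definition subsequential_code ::
  "('q \<Rightarrow> nat) \<Rightarrow> ('a \<Rightarrow> nat) \<Rightarrow> ('b \<Rightarrow> nat) \<Rightarrow> 'a set \<Rightarrow> 'b set \<Rightarrow> ('q, 'a, 'b) transducer \<Rightarrow>
     ('q \<Rightarrow> 'b) \<Rightarrow> nat \<Rightarrow> bool" where
  "subsequential_code \<kappa> \<alpha> \<beta> A B T t d \<longleftrightarrow>
     (\<exists>c ct. transducer_code \<kappa> \<alpha> \<beta> A B T c \<and>
        lists_set (\<lambda>q. prod_encode (\<kappa> q, \<beta> (t q))) (final T) ct \<and>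
        d = prod_encode (c, ct))"

end

theory Submission
  imports Defs
begin

text \<open>
  Let \<open>E\<close> be the transitive closure of the prefix closure and \<open>S\<close> the syntactic congruence. An
  \<open>E\<close>-class contains boundedly many \<open>S\<close>-classes, which can be numbered; which of them merge or
  become \<open>R\<close>-equivalent after a common continuation is determined by the residuals of \<open>R\<close>
  (as a language of pairs of words), of which there are finitely many. Hence the number of the
  \<open>S\<close>-class of the input together with the matrix of residuals of its \<open>E\<close>-class is a finite state
  that can be updated letter by letter. Each output letter names the \<open>E\<close>-class of the extended word
  among the children of the previous one, so the output identifies the \<open>E\<close>-class; the final output
  names the \<open>R\<close>-class inside it.

  For effectivity, it suffices to search for a machine with kernel \<open>R\<close>: two words on which a candidate
  fails can be cut down to a length bounded in terms of the number of residuals and of states, so that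
  each candidate is tested on finitely many words.
\<close>

section \<open>Computable functions\<close>

text \<open>The relation \<open>E\<close> is forced. If a sequential letter-to-letter machine has
  kernel R, then R-equivalent words uu' and vv' with |u'| = |v'| produce the same letters along u
  and v, and producing the same letters is transitive. So the letters can at best separate
  \<open>E\<close>-classes, and the final output has to separate the R-classes inside one
  \<open>E\<close>-class. The obstacle is that an arbitrary numbering of \<open>S\<close>-classes
  cannot be updated by a finite-state device. A class is therefore described by its pairs (number of
  a predecessor class, letter), and the numbers are selected by a choice that sees only the family
  of these descriptions. Then \<open>E\<close>-classes with equal residual matrices have children
  that are numbered alike. Residuals are finite in number because a length-preserving transducer has
  bounded delay: what is left to read can be kept short. The existence proof uses non-effective
  choices and is not itself made into a program; it guarantees that the search halts. The bounds of
  the test are computed from the codes of the transducer and of the candidate.\<close>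

definition recursive :: "nat \<Rightarrow> (nat list \<Rightarrow> nat) \<Rightarrow> bool" where
  "recursive k F \<longleftrightarrow> (\<exists>r. \<forall>xs. length xs = k \<longrightarrow> computes r xs (F xs))"

lemma recursive_cong:
  "recursive k F \<Longrightarrow> (\<And>xs. length xs = k \<Longrightarrow> F xs = G xs) \<Longrightarrow> recursive k G"
  unfolding recursive_def by metis

lemma recursive_nth: "i < k \<Longrightarrow> recursive k (\<lambda>xs. xs ! i)"
  unfolding recursive_def by (metis computes.intros(3))

lemma recursive_compose:
  assumes "recursive (length Gs) F" "\<And>G. G \<in> set Gs \<Longrightarrow> recursive k G"
  shows "recursive k (\<lambda>xs. F (map (\<lambda>G. G xs) Gs))"
proof -
  obtain f where f: "\<And>xs. length xs = length Gs \<Longrightarrow> computes f xs (F xs)"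
    using assms(1) unfolding recursive_def by blast
  have "\<forall>G \<in> set Gs. \<exists>r. \<forall>xs. length xs = k \<longrightarrow> computes r xs (G xs)"
    using assms(2) unfolding recursive_def by blast
  then obtain g where g: "\<And>G xs. G \<in> set Gs \<Longrightarrow> length xs = k \<Longrightarrow> computes (g G) xs (G xs)"
    by metis
  have "computes (Compose f (map g Gs)) xs (F (map (\<lambda>G. G xs) Gs))" if "length xs = k" for xs
    by (rule computes.intros(4)[where ys = "map (\<lambda>G. G xs) Gs"])
      (use that g f in \<open>auto simp: list_all2_conv_all_nth\<close>)
  then show ?thesis unfolding recursive_def by blast
qed

lemma recursive_compose1:
  assumes "recursive 1 (\<lambda>xs. f (xs ! 0))" "recursive k G"
  shows "recursive k (\<lambda>xs. f (G xs))"
  using recursive_compose[of "[G]" "\<lambda>xs. f (xs ! 0)" k] assms by simp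

lemma recursive_compose2:
  assumes "recursive 2 (\<lambda>xs. f (xs ! 0) (xs ! 1))" "recursive k G" "recursive k H"
  shows "recursive k (\<lambda>xs. f (G xs) (H xs))"
  using recursive_compose[of "[G, H]" "\<lambda>xs. f (xs ! 0) (xs ! 1)" k] assms
  by (auto simp: numeral_2_eq_2)

lemma recursive_rec:
  assumes "recursive k Z" "recursive (Suc (Suc k)) S"
  shows "recursive (Suc k) (\<lambda>xs. rec_nat (Z (tl xs)) (\<lambda>n y. S (n # y # tl xs)) (hd xs))"
proof -
  obtain f where f: "\<And>xs. length xs = k \<Longrightarrow> computes f xs (Z xs)"
    using assms(1) unfolding recursive_def by blast
  obtain g where g: "\<And>xs. length xs = Suc (Suc k) \<Longrightarrow> computes g xs (S xs)"
    using assms(2) unfolding recursive_def by blast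
  have "computes (PrimRec f g) (n # xs) (rec_nat (Z xs) (\<lambda>n y. S (n # y # xs)) n)"
    if "length xs = k" for n xs
    by (induction n) (use that f g computes.intros(5,6) in auto)
  then have "computes (PrimRec f g) xs (rec_nat (Z (tl xs)) (\<lambda>n y. S (n # y # tl xs)) (hd xs))"
    if "length xs = Suc k" for xs
    using that by (cases xs) auto
  then show ?thesis unfolding recursive_def by blast
qed

lemma recursive_rec1:
  assumes "recursive 2 (\<lambda>xs. s (xs ! 0) (xs ! 1))"
  shows "recursive 1 (\<lambda>xs. rec_nat 0 (\<lambda>n y. s n y) (xs ! 0))"
proof -
  have "recursive 0 (\<lambda>_. 0)"
    unfolding recursive_def by (metis computes.intros(1))
  then show ?thesis
    using recursive_rec[of 0 "\<lambda>_. 0" "\<lambda>xs. s (xs ! 0) (xs ! 1)"] assms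
    by (auto simp: numeral_2_eq_2 length_Suc_conv elim!: recursive_cong)
qed

lemma recursive_rec2:
  assumes "recursive 1 (\<lambda>xs. z (xs ! 0))" "recursive 3 (\<lambda>xs. s (xs ! 0) (xs ! 1) (xs ! 2))"
  shows "recursive 2 (\<lambda>xs. rec_nat (z (xs ! 1)) (\<lambda>n y. s n y (xs ! 1)) (xs ! 0))"
  using recursive_rec[of 1 "\<lambda>xs. z (xs ! 0)" "\<lambda>xs. s (xs ! 0) (xs ! 1) (xs ! 2)"] assms
  by (auto simp: numeral_eq_Suc length_Suc_conv elim!: recursive_cong)

lemma recursive_Suc: "recursive k G \<Longrightarrow> recursive k (\<lambda>xs. Suc (G xs))"
proof (rule recursive_compose1[where f = Suc])
  have "computes Succ xs (Suc (xs ! 0))" if "length xs = 1" for xs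
    using that computes.intros(2) by (auto simp: length_Suc_conv)
  then show "recursive 1 (\<lambda>xs. Suc (xs ! 0))" unfolding recursive_def by blast
qed

lemma recursive_const: "recursive k (\<lambda>_. n)"
proof (induction n)
  case 0
  then show ?case unfolding recursive_def by (metis computes.intros(1))
qed (rule recursive_Suc)

lemma recursive_add:
  assumes "recursive k G" "recursive k H"
  shows "recursive k (\<lambda>xs. G xs + H xs)"
proof (rule recursive_compose2[OF _ assms])
  have "rec_nat m (\<lambda>_ y. Suc y) n = n + m" for n m :: nat
    by (induction n) auto
  then show "recursive 2 (\<lambda>xs. xs ! 0 + xs ! 1)"
    using recursive_rec2[of "\<lambda>x. x" "\<lambda>_ y _. Suc y"]
    by (simp add: recursive_Suc recursive_nth)
qed

lemma recursive_pred:
  assumes "recursive k G"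
  shows "recursive k (\<lambda>xs. G xs - 1)"
proof (rule recursive_compose1[OF _ assms])
  have "rec_nat 0 (\<lambda>n _. n) n = n - 1" for n :: nat
    by (cases n) auto
  then show "recursive 1 (\<lambda>xs. xs ! 0 - 1)"
    using recursive_rec1[of "\<lambda>n _. n"] by (simp add: recursive_nth)
qed

lemma recursive_diff:
  assumes "recursive k G" "recursive k H"
  shows "recursive k (\<lambda>xs. G xs - H xs)"
\<comment> \<open>The recursion iterates the predecessor and runs on the subtrahend, so the
  arguments are swapped.\<close>
proof (rule recursive_compose2[OF _ assms(2,1), where f = "\<lambda>x y. y - x"])
  have "rec_nat m (\<lambda>_ y. y - 1) n = m - n" for n m :: nat
    by (induction n) auto
  then show "recursive 2 (\<lambda>xs. xs ! 1 - xs ! 0)"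
    using recursive_rec2[of "\<lambda>x. x" "\<lambda>_ y _. y - 1"] recursive_pred[OF recursive_nth, of 1 3]
    by (simp add: recursive_nth)
qed

lemma recursive_mult:
  assumes "recursive k G" "recursive k H"
  shows "recursive k (\<lambda>xs. G xs * H xs)"
proof (rule recursive_compose2[OF _ assms])
  have "rec_nat 0 (\<lambda>_ y. y + m) n = n * m" for n m :: nat
    by (induction n) auto
  then show "recursive 2 (\<lambda>xs. xs ! 0 * xs ! 1)"
    using recursive_rec2[of "\<lambda>_. 0" "\<lambda>_ y m. y + m"]
    by (simp add: recursive_const recursive_add recursive_nth)
qed

lemma recursive_triangle:
  assumes "recursive k G"
  shows "recursive k (\<lambda>xs. triangle (G xs))"
proof (rule recursive_compose1[OF _ assms])
  have "rec_nat 0 (\<lambda>n y. y + Suc n) n = triangle n" for n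
    by (induction n) auto
  moreover have "recursive 2 (\<lambda>xs. xs ! 1 + Suc (xs ! 0))"
    by (intro recursive_add recursive_Suc recursive_nth) auto
  ultimately show "recursive 1 (\<lambda>xs. triangle (xs ! 0))"
    using recursive_rec1[of "\<lambda>n y. y + Suc n"] by simp
qed

lemma recursive_prod_encode:
  assumes "recursive k G" "recursive k H"
  shows "recursive k (\<lambda>xs. prod_encode (G xs, H xs))"
  unfolding prod_encode_def using assms
  by (simp add: recursive_add recursive_triangle)

section \<open>Inverting the pairing function\<close>

definition pfst :: "nat \<Rightarrow> nat" where "pfst z = fst (prod_decode z)"
definition psnd :: "nat \<Rightarrow> nat" where "psnd z = snd (prod_decode z)"

lemma pfst_prod_encode [simp]: "pfst (prod_encode (a, b)) = a"
  and psnd_prod_encode [simp]: "psnd (prod_encode (a, b)) = b"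
  by (simp_all add: pfst_def psnd_def)

text \<open>The number a + b of the diagonal containing the pair (a, b) coded by z, that is the
  largest d with \<open>triangle d \<le> z\<close>. From z to \<open>Suc z\<close> it grows by 0 or
  1; the truncated subtraction gives 1 exactly if
  \<open>triangle (Suc y) \<le> Suc z\<close>.\<close>

definition diagonal :: "nat \<Rightarrow> nat" where
  "diagonal = rec_nat 0 (\<lambda>z y. y + (1 - (triangle (Suc y) - Suc z)))"

lemma diagonal_bounds: "triangle (diagonal z) \<le> z \<and> z < triangle (Suc (diagonal z))"
proof (induction z)
  case (Suc z)
  have "diagonal (Suc z) = diagonal z + (1 - (triangle (Suc (diagonal z)) - Suc z))"
    by (simp add: diagonal_def)
  then show ?case
    using Suc by (cases "triangle (Suc (diagonal z)) \<le> Suc z") auto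
qed (simp add: diagonal_def)

lemma triangle_mono: "m \<le> n \<Longrightarrow> triangle m \<le> triangle n"
  by (induction n) (auto simp: le_Suc_eq)

lemma diagonal_prod_encode: "diagonal (prod_encode (a, b)) = a + b"
proof -
  define z where "z = prod_encode (a, b)"
  have *: "triangle (a + b) \<le> z" "z < triangle (Suc (a + b))"
    by (auto simp: z_def prod_encode_def)
  show ?thesis
    using * diagonal_bounds[of z] triangle_mono[of "Suc (diagonal z)" "a + b"]
      triangle_mono[of "Suc (a + b)" "diagonal z"]
    by (fold z_def) linarith
qed

lemma pfst_eq: "pfst z = z - triangle (diagonal z)"
  and psnd_eq: "psnd z = diagonal z - pfst z"
proof -
  obtain a b where "z = prod_encode (a, b)"
    by (metis prod_decode_inverse surj_pair)
  then show "pfst z = z - triangle (diagonal z)" "psnd z = diagonal z - pfst z"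
    by (auto simp: diagonal_prod_encode) (simp add: prod_encode_def)
qed

lemma recursive_diagonal:
  assumes "recursive k G"
  shows "recursive k (\<lambda>xs. diagonal (G xs))"
proof (rule recursive_compose1[OF _ assms])
  have "recursive 2 (\<lambda>xs. xs ! 1 + (1 - (triangle (Suc (xs ! 1)) - Suc (xs ! 0))))"
    by (intro recursive_add recursive_diff recursive_const recursive_triangle recursive_Suc
        recursive_nth) auto
  then show "recursive 1 (\<lambda>xs. diagonal (xs ! 0))"
    unfolding diagonal_def by (rule recursive_rec1)
qed

subsection \<open>Computability relative to an environment\<close>

text \<open>The argument of the functions below codes a nested tuple of variables: a bound variable is
  added by pairing, so that the computability of a term can be derived by backward resolution
  along its structure.\<close>

definition cn :: "(nat \<Rightarrow> nat) \<Rightarrow> bool" where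
  "cn F \<longleftrightarrow> (\<exists>r. \<forall>x. computes r [x] (F x))"

definition cb :: "(nat \<Rightarrow> bool) \<Rightarrow> bool" where
  "cb P \<longleftrightarrow> cn (\<lambda>e. of_bool (P e))"

definition cl :: "(nat \<Rightarrow> nat list) \<Rightarrow> bool" where
  "cl G \<longleftrightarrow> cn (\<lambda>e. list_encode (G e))"

named_theorems comp_intros

lemma cn_iff_recursive: "cn F \<longleftrightarrow> recursive 1 (\<lambda>xs. F (xs ! 0))"
  unfolding cn_def recursive_def
  by (rule iff_exI) (auto simp: length_Suc_conv)

lemma cn_compose: "cn F \<Longrightarrow> cn G \<Longrightarrow> cn (\<lambda>e. F (G e))"
  unfolding cn_iff_recursive by (rule recursive_compose1)

lemma cb_compose: "cb P \<Longrightarrow> cn G \<Longrightarrow> cb (\<lambda>e. P (G e))"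
  unfolding cb_def by (rule cn_compose)

lemma cl_compose: "cl F \<Longrightarrow> cn G \<Longrightarrow> cl (\<lambda>e. F (G e))"
  unfolding cl_def by (rule cn_compose)

lemma cn_const [comp_intros]: "cn (\<lambda>_. n)"
  unfolding cn_iff_recursive by (rule recursive_const)

lemma cn_id [comp_intros]: "cn (\<lambda>e. e)"
  unfolding cn_iff_recursive by (simp add: recursive_nth)

lemma cn_Suc [comp_intros]: "cn F \<Longrightarrow> cn (\<lambda>e. Suc (F e))"
  unfolding cn_iff_recursive by (rule recursive_Suc)

lemma cn_add [comp_intros]: "cn F \<Longrightarrow> cn G \<Longrightarrow> cn (\<lambda>e. F e + G e)"
  unfolding cn_iff_recursive by (rule recursive_add)

lemma cn_diff [comp_intros]: "cn F \<Longrightarrow> cn G \<Longrightarrow> cn (\<lambda>e. F e - G e)"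
  unfolding cn_iff_recursive by (rule recursive_diff)

lemma cn_mult [comp_intros]: "cn F \<Longrightarrow> cn G \<Longrightarrow> cn (\<lambda>e. F e * G e)"
  unfolding cn_iff_recursive by (rule recursive_mult)

lemma cn_prod_encode [comp_intros]: "cn F \<Longrightarrow> cn G \<Longrightarrow> cn (\<lambda>e. prod_encode (F e, G e))"
  unfolding cn_iff_recursive by (rule recursive_prod_encode)

lemma cn_pfst [comp_intros]: "cn F \<Longrightarrow> cn (\<lambda>e. pfst (F e))"
  unfolding cn_iff_recursive pfst_eq
  by (intro recursive_diff recursive_triangle recursive_diagonal)

lemma cn_psnd [comp_intros]: "cn F \<Longrightarrow> cn (\<lambda>e. psnd (F e))"
  unfolding cn_iff_recursive psnd_eq pfst_eq
  by (intro recursive_diff recursive_triangle recursive_diagonal)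

text \<open>The step reads its variables from the code of ((e, n), y), with one pairing per binder;
  the rules for other binding constructs use the same layout.\<close>

lemma cn_rec [comp_intros]:
  assumes "cn Z" "cn (\<lambda>z. S (pfst (pfst z)) (psnd (pfst z)) (psnd z))" "cn F"
  shows "cn (\<lambda>e. rec_nat (Z e) (\<lambda>n y. S e n y) (F e))"
proof -
  define s where "s n y e = S e n y" for n y e
  have "recursive 3 (\<lambda>xs. prod_encode (prod_encode (xs ! 2, xs ! 0), xs ! 1))"
    by (intro recursive_prod_encode recursive_nth) auto
  with assms(2) have "recursive 3 (\<lambda>xs. s (xs ! 0) (xs ! 1) (xs ! 2))"
    unfolding cn_iff_recursive s_def
    using recursive_compose1[where f = "\<lambda>z. S (pfst (pfst z)) (psnd (pfst z)) (psnd z)"] by fastforce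
  from recursive_rec2[OF _ this, of Z] assms(1)
  have "recursive 2 (\<lambda>xs. rec_nat (Z (xs ! 1)) (\<lambda>n y. s n y (xs ! 1)) (xs ! 0))"
    unfolding cn_iff_recursive by blast
  from recursive_compose2[OF this, of 1 "\<lambda>xs. F (xs ! 0)" "\<lambda>xs. xs ! 0"] assms(3)
  show ?thesis
    unfolding cn_iff_recursive s_def by (simp add: recursive_nth)
qed

section \<open>Decidable predicates and bounded quantifiers\<close>

lemma cb_le [comp_intros]:
  assumes "cn F" "cn G"
  shows "cb (\<lambda>e. F e \<le> G e)"
proof -
  have "cn (\<lambda>e. 1 - (F e - G e))" by (intro comp_intros assms)
  moreover have "1 - (F e - G e) = of_bool (F e \<le> G e)" for e by auto
  ultimately show ?thesis by (simp add: cb_def)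
qed

lemma cb_not [comp_intros]:
  assumes "cb P"
  shows "cb (\<lambda>e. \<not> P e)"
proof -
  have "cn (\<lambda>e. 1 - of_bool (P e))" by (intro comp_intros assms[unfolded cb_def])
  moreover have "1 - of_bool (P e) = (of_bool (\<not> P e) :: nat)" for e by auto
  ultimately show ?thesis by (simp add: cb_def)
qed

lemma cb_conj [comp_intros]:
  assumes "cb P" "cb Q"
  shows "cb (\<lambda>e. P e \<and> Q e)"
proof -
  have "cn (\<lambda>e. of_bool (P e) * of_bool (Q e))" by (intro comp_intros assms[unfolded cb_def])
  then show ?thesis by (simp add: cb_def of_bool_conj)
qed

lemma cb_imp [comp_intros]: "cb P \<Longrightarrow> cb Q \<Longrightarrow> cb (\<lambda>e. P e \<longrightarrow> Q e)"
  using cb_not[OF cb_conj[OF _ cb_not], of P Q] by simp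

lemma cb_iff [comp_intros]: "cb P \<Longrightarrow> cb Q \<Longrightarrow> cb (\<lambda>e. P e \<longleftrightarrow> Q e)"
  unfolding iff_conv_conj_imp by (intro comp_intros)

lemma cb_eq [comp_intros]: "cn F \<Longrightarrow> cn G \<Longrightarrow> cb (\<lambda>e. F e = G e)"
  unfolding order_eq_iff by (intro comp_intros)

text \<open>A bounded quantifier is a product of truth values, computed by recursion on the
  bound.\<close>

lemma cb_all_less [comp_intros]:
  assumes "cn F" "cb (\<lambda>z. P (pfst z) (psnd z))"
  shows "cb (\<lambda>e. \<forall>i < F e. P e i)"
proof -
  have "cn (\<lambda>z. of_bool (P (pfst (pfst z)) (psnd (pfst z))))"
    using cb_compose[OF assms(2), of pfst] unfolding cb_def by (simp add: cn_pfst cn_id)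
  then have "cn (\<lambda>e. rec_nat 1 (\<lambda>i y :: nat. y * of_bool (P e i)) (F e))"
    by (intro comp_intros assms)
  moreover have "rec_nat 1 (\<lambda>i y :: nat. y * of_bool (P e i)) n = of_bool (\<forall>i<n. P e i)" for e n
    by (induction n) (auto simp: less_Suc_eq)
  ultimately show ?thesis by (simp add: cb_def)
qed

lemma cb_ex_less [comp_intros]:
  assumes "cn F" "cb (\<lambda>z. P (pfst z) (psnd z))"
  shows "cb (\<lambda>e. \<exists>i < F e. P e i)"
  using cb_not[OF cb_all_less[OF assms(1) cb_not[OF assms(2)]]] by simp

lemma cn_if [comp_intros]:
  assumes "cb P" "cn F" "cn G"
  shows "cn (\<lambda>e. if P e then F e else G e)"
proof -
  have "cn (\<lambda>e. of_bool (P e) * F e + (1 - of_bool (P e)) * G e)"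
    by (intro comp_intros assms assms(1)[unfolded cb_def])
  moreover have "of_bool (P e) * F e + (1 - of_bool (P e)) * G e = (if P e then F e else G e)" for e
    by auto
  ultimately show ?thesis by simp
qed

lemma cl_if [comp_intros]:
  assumes "cb P" "cl F" "cl G"
  shows "cl (\<lambda>e. if P e then F e else G e)"
  using cn_if[OF assms(1) assms(2,3)[unfolded cl_def]] by (simp add: cl_def if_distrib)

lemma cb_eq_list [comp_intros]: "cl F \<Longrightarrow> cl G \<Longrightarrow> cb (\<lambda>e. F e = G e)"
  unfolding cl_def using cb_eq[of "\<lambda>e. list_encode (F e)" "\<lambda>e. list_encode (G e)"]
  by (simp add: list_encode_eq)

lemma cn_mod [comp_intros]:
  assumes "cn F" "cn G"
  shows "cn (\<lambda>e. F e mod G e)"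
proof -
  \<comment> \<open>A counter that restarts when it reaches the modulus; with modulus 0 it never
    restarts, in accordance with \<open>n mod 0 = n\<close>.\<close>
  have "cn (\<lambda>e. rec_nat 0 (\<lambda>_ y. if Suc y = G e then 0 else Suc y) (F e))"
    by (intro comp_intros assms cn_compose[OF assms(2)])
  moreover have "rec_nat 0 (\<lambda>_ y. if Suc y = m then 0 else Suc y) n = n mod m" for m n :: nat
    by (induction n) (auto simp: mod_Suc)
  ultimately show ?thesis by simp
qed

lemma cn_power [comp_intros]:
  assumes "cn F" "cn G"
  shows "cn (\<lambda>e. F e ^ G e)"
proof -
  have "cn (\<lambda>e. rec_nat 1 (\<lambda>_ y. y * F e) (G e))"
    by (intro comp_intros assms cn_compose[OF assms(1)])
  moreover have "rec_nat 1 (\<lambda>_ y. y * m) n = m ^ n" for m n :: nat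
    by (induction n) auto
  ultimately show ?thesis by simp
qed

section \<open>Lists handled through their codes\<close>

definition hd0 :: "nat list \<Rightarrow> nat" where
  "hd0 xs = (case xs of [] \<Rightarrow> 0 | x # _ \<Rightarrow> x)"

lemma hd0_simps [simp]: "hd0 [] = 0" "hd0 (x # xs) = x"
  by (simp_all add: hd0_def)

definition nth0 :: "nat list \<Rightarrow> nat \<Rightarrow> nat" where
  "nth0 xs i = hd0 (drop i xs)"

lemma nth0_eq: "nth0 xs i = (if i < length xs then xs ! i else 0)"
  by (auto simp: nth0_def Cons_nth_drop_Suc[symmetric])

lemma pfst_0 [simp]: "pfst 0 = 0" and psnd_0 [simp]: "psnd 0 = 0"
  by (simp_all add: pfst_eq psnd_eq diagonal_def)

lemma cl_Nil [comp_intros]: "cl (\<lambda>_. [])"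
  by (simp add: cl_def cn_const)

lemma cl_Cons [comp_intros]: "cn F \<Longrightarrow> cl G \<Longrightarrow> cl (\<lambda>e. F e # G e)"
  unfolding cl_def list_encode.simps by (intro comp_intros)

lemma cl_list_decode [comp_intros]: "cn F \<Longrightarrow> cl (\<lambda>e. list_decode (F e))"
  by (simp add: cl_def)

lemma cn_list_encode [comp_intros]: "cl G \<Longrightarrow> cn (\<lambda>e. list_encode (G e))"
  by (simp add: cl_def)

text \<open>The default of \<open>hd0\<close> is what the computation yields on the empty list: its
  code is 0, \<open>0 - 1 = 0\<close> and \<open>pfst 0 = 0\<close>.\<close>

lemma cn_hd0 [comp_intros]:
  assumes "cl G"
  shows "cn (\<lambda>e. hd0 (G e))"
proof -
  have "cn (\<lambda>e. pfst (list_encode (G e) - 1))" by (intro comp_intros assms)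
  moreover have "pfst (list_encode xs - 1) = hd0 xs" for xs by (cases xs) auto
  ultimately show ?thesis by simp
qed

lemma cl_tl [comp_intros]:
  assumes "cl G"
  shows "cl (\<lambda>e. tl (G e))"
proof -
  have "cn (\<lambda>e. psnd (list_encode (G e) - 1))" by (intro comp_intros assms)
  moreover have "psnd (list_encode xs - 1) = list_encode (tl xs)" for xs by (cases xs) auto
  ultimately show ?thesis by (simp add: cl_def)
qed

lemma cl_rec [comp_intros]:
  assumes "cl Z" "cl (\<lambda>z. S (pfst (pfst z)) (psnd (pfst z)) (list_decode (psnd z)))" "cn F"
  shows "cl (\<lambda>e. rec_nat (Z e) (\<lambda>n y. S e n y) (F e))"
proof -
  have "cn (\<lambda>e. rec_nat (list_encode (Z e)) (\<lambda>n y. list_encode (S e n (list_decode y))) (F e))"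
    by (intro comp_intros assms)
  moreover have "rec_nat (list_encode (Z e)) (\<lambda>n y. list_encode (S e n (list_decode y))) m
      = list_encode (rec_nat (Z e) (\<lambda>n y. S e n y) m)" for e m
    by (induction m) auto
  ultimately show ?thesis by (simp add: cl_def)
qed

lemma cl_drop [comp_intros]:
  assumes "cn F" "cl G"
  shows "cl (\<lambda>e. drop (F e) (G e))"
proof -
  have "cl (\<lambda>e. rec_nat (G e) (\<lambda>_ ys. tl ys) (F e))"
    by (intro comp_intros assms)
  moreover have "rec_nat xs (\<lambda>_ ys. tl ys) n = drop n xs" for n and xs :: "nat list"
    by (induction n) (auto simp: drop_Suc tl_drop)
  ultimately show ?thesis by simp
qed

lemma cn_nth0 [comp_intros]: "cl G \<Longrightarrow> cn F \<Longrightarrow> cn (\<lambda>e. nth0 (G e) (F e))"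
  unfolding nth0_def by (intro comp_intros)

lemma le_prod_encode: "a + b \<le> prod_encode (a, b)"
proof -
  have "n \<le> triangle n" for n by (induction n) auto
  from this[of "a + b"] show ?thesis by (simp add: prod_encode_def)
qed

lemma length_le_list_encode: "length xs \<le> list_encode xs"
proof (induction xs)
  case (Cons x xs)
  then show ?case using le_prod_encode[of x "list_encode xs"] by simp
qed simp

lemma mem_less_list_encode: "x \<in> set xs \<Longrightarrow> x < list_encode xs"
proof (induction xs)
  case (Cons y xs)
  then show ?case using le_prod_encode[of y "list_encode xs"] by fastforce
qed simp

lemma fold_take_Suc:
  "i < length xs \<Longrightarrow> fold f (take (Suc i) xs) s = f (xs ! i) (fold f (take i xs) s)"
  by (simp add: take_Suc_conv_app_nth)

text \<open>The code of a list is at least its length, so it can serve as the number of rounds of a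
  loop over the positions; rounds past the end leave the value as it is.\<close>

lemma fold_eq_rec_nat:
  "rec_nat s (\<lambda>i y. if drop i xs = [] then y else f (nth0 xs i) y) (list_encode xs) = fold f xs s"
proof -
  have "rec_nat s (\<lambda>i y. if drop i xs = [] then y else f (nth0 xs i) y) n = fold f (take n xs) s" for n
  proof (induction n)
    case (Suc n)
    then show ?case
      by (cases "n < length xs") (auto simp: nth0_eq fold_take_Suc)
  qed simp
  then show ?thesis by (simp add: length_le_list_encode)
qed

lemma cn_fold [comp_intros]:
  assumes "cl G" "cn (\<lambda>z. H (pfst (pfst z)) (psnd (pfst z)) (psnd z))" "cn Z"
  shows "cn (\<lambda>e. fold (\<lambda>x y. H e x y) (G e) (Z e))"
proof -
  have "cn (\<lambda>z. H (pfst (pfst z)) (nth0 (G (pfst (pfst z))) (psnd (pfst z))) (psnd z))"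
    using cn_compose[OF assms(2), of "\<lambda>z. prod_encode (prod_encode (pfst (pfst z),
      nth0 (G (pfst (pfst z))) (psnd (pfst z))), psnd z)"]
    by (simp add: cn_prod_encode cn_pfst cn_psnd cn_id cn_nth0 cl_compose[OF assms(1)])
  then have "cn (\<lambda>e. rec_nat (Z e) (\<lambda>i y. if drop i (G e) = [] then y else H e (nth0 (G e) i) y)
      (list_encode (G e)))"
    by (intro comp_intros assms cl_compose[OF assms(1)])
  then show ?thesis unfolding fold_eq_rec_nat .
qed

lemma cl_fold [comp_intros]:
  assumes "cl G" "cl (\<lambda>z. H (pfst (pfst z)) (psnd (pfst z)) (list_decode (psnd z)))" "cl Z"
  shows "cl (\<lambda>e. fold (\<lambda>x y. H e x y) (G e) (Z e))"
proof -
  have "cn (\<lambda>e. fold (\<lambda>x y. list_encode (H e x (list_decode y))) (G e) (list_encode (Z e)))"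
    by (intro comp_intros assms)
  moreover have "fold (\<lambda>x y. list_encode (H e x (list_decode y))) xs (list_encode s)
      = list_encode (fold (\<lambda>x y. H e x y) xs s)" for e xs s
    by (induction xs arbitrary: s) auto
  ultimately show ?thesis by (simp add: cl_def)
qed

lemma cl_rev [comp_intros]: "cl G \<Longrightarrow> cl (\<lambda>e. rev (G e))"
  unfolding rev_conv_fold by (intro comp_intros)

lemma cl_append [comp_intros]:
  assumes "cl F" "cl G"
  shows "cl (\<lambda>e. F e @ G e)"
proof -
  have "cl (\<lambda>e. fold (\<lambda>x y. x # y) (rev (F e)) (G e))" by (intro comp_intros assms)
  moreover have "fold (\<lambda>x y. x # y) (rev xs) ys = xs @ ys" for xs ys :: "nat list"
    by (induction xs) auto
  ultimately show ?thesis by simp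
qed

lemma cl_concat_map [comp_intros]:
  assumes "cl G" "cl (\<lambda>z. H (pfst z) (psnd z))"
  shows "cl (\<lambda>e. concat (map (\<lambda>x. H e x) (G e)))"
proof -
  have "cl (\<lambda>z. H (pfst (pfst z)) (psnd (pfst z)))"
    using cl_compose[OF assms(2), of pfst] by (simp add: cn_pfst cn_id)
  then have "cl (\<lambda>e. fold (\<lambda>x y. y @ H e x) (G e) [])"
    by (intro comp_intros assms)
  moreover have "fold (\<lambda>x y. y @ H e x) xs s = s @ concat (map (\<lambda>x. H e x) xs)" for e xs s
    by (induction xs arbitrary: s) auto
  ultimately show ?thesis by simp
qed

lemma cl_map [comp_intros]:
  assumes "cl G" "cn (\<lambda>z. H (pfst z) (psnd z))"
  shows "cl (\<lambda>e. map (\<lambda>x. H e x) (G e))"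
proof -
  have "cl (\<lambda>e. concat (map (\<lambda>x. [H e x]) (G e)))" by (intro comp_intros assms)
  then show ?thesis by simp
qed

lemma cl_upt [comp_intros]:
  assumes "cn F"
  shows "cl (\<lambda>e. [0..<F e])"
proof -
  have "cl (\<lambda>e. rec_nat [] (\<lambda>n y. y @ [n]) (F e))" by (intro comp_intros assms)
  moreover have "rec_nat [] (\<lambda>n y. y @ [n]) n = [0..<n]" for n by (induction n) auto
  ultimately show ?thesis by simp
qed

lemma cb_ball_set [comp_intros]:
  assumes "cl G" "cb (\<lambda>z. P (pfst z) (psnd z))"
  shows "cb (\<lambda>e. \<forall>x \<in> set (G e). P e x)"
proof -
  have "cb (\<lambda>z. P (pfst z) (nth0 (G (pfst z)) (psnd z)))"
    using cb_compose[OF assms(2), of "\<lambda>z. prod_encode (pfst z, nth0 (G (pfst z)) (psnd z))"]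
    by (simp add: cn_prod_encode cn_pfst cn_psnd cn_id cn_nth0 cl_compose[OF assms(1)])
  then have "cb (\<lambda>e. \<forall>i < list_encode (G e). drop i (G e) \<noteq> [] \<longrightarrow> P e (nth0 (G e) i))"
    by (intro comp_intros assms cl_compose[OF assms(1)])
  moreover have "(\<forall>i < list_encode xs. drop i xs \<noteq> [] \<longrightarrow> P e (nth0 xs i)) \<longleftrightarrow> (\<forall>x \<in> set xs. P e x)"
    for e xs
    using length_le_list_encode[of xs] by (auto simp: nth0_eq all_set_conv_all_nth)
  ultimately show ?thesis by simp
qed

lemma cb_bex_set [comp_intros]:
  assumes "cl G" "cb (\<lambda>z. P (pfst z) (psnd z))"
  shows "cb (\<lambda>e. \<exists>x \<in> set (G e). P e x)"
  using cb_not[OF cb_ball_set[OF assms(1) cb_not[OF assms(2)]]] by simp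

lemma cb_mem_set [comp_intros]:
  assumes "cn F" "cl G"
  shows "cb (\<lambda>e. F e \<in> set (G e))"
proof -
  have "cb (\<lambda>e. \<exists>x \<in> set (G e). x = F e)"
    by (intro comp_intros assms cn_compose[OF assms(1)])
  then show ?thesis by simp
qed

text \<open>The program depends on P and F alone, so that one program serves all inputs c: this
  uniformity is what effectivity asks for. As P is decidable, minimization passes every failing
  candidate. The candidate is the first component of the environment of P because
  \<open>Minimize\<close> puts it in front of the arguments.\<close>

lemma computes_search:
  assumes P: "cb (\<lambda>z. P (psnd z) (pfst z))" and F: "cn (\<lambda>z. F (pfst z) (psnd z))"
  obtains r where
    "\<And>c. \<exists>n. P c n \<Longrightarrow> \<exists>n. P c n \<and> computes r [c] (F c n)"
proof -
  \<comment> \<open>Truth values are flipped, since \<open>Minimize\<close> looks for the value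
    0.\<close>
  have "recursive 2 (\<lambda>xs. 1 - of_bool (P (psnd (prod_encode (xs ! 0, xs ! 1)))
      (pfst (prod_encode (xs ! 0, xs ! 1)))))"
    using recursive_compose1[where f = "\<lambda>z. of_bool (P (psnd z) (pfst z))" and k = 2,
        OF _ recursive_prod_encode[OF recursive_nth recursive_nth]] P[unfolded cb_def cn_iff_recursive]
    by (intro recursive_diff recursive_const) auto
  then obtain p where p: "\<And>xs. length xs = 2 \<Longrightarrow> computes p xs (1 - of_bool (P (xs ! 1) (xs ! 0)))"
    unfolding recursive_def by auto
  have "recursive 2 (\<lambda>xs. F (pfst (prod_encode (xs ! 1, xs ! 0))) (psnd (prod_encode (xs ! 1, xs ! 0))))"
    using recursive_compose1[where f = "\<lambda>z. F (pfst z) (psnd z)" and k = 2,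
        OF _ recursive_prod_encode[OF recursive_nth recursive_nth]] F[unfolded cn_iff_recursive]
    by auto
  then obtain f where f: "\<And>xs. length xs = 2 \<Longrightarrow> computes f xs (F (xs ! 1) (xs ! 0))"
    unfolding recursive_def by auto
  show ?thesis
  proof
    fix c assume ex: "\<exists>n. P c n"
    define n where "n = (LEAST n. P c n)"
    have n: "P c n" using ex unfolding n_def by (rule LeastI_ex)
    have "\<exists>k. computes p [m, c] (Suc k)" if "m < n" for m
      using p[of "[m, c]"] not_less_Least[OF that[unfolded n_def]] by auto
    moreover have "computes p [n, c] 0" using p[of "[n, c]"] n by simp
    ultimately have "computes (Minimize p) [c] n" by (intro computes.intros(7))
    moreover have "computes (Proj 0) [c] c" using computes.intros(3)[of 0 "[c]"] by simp
    ultimately have "computes (Compose f [Minimize p, Proj 0]) [c] (F c n)"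
      using f[of "[n, c]"] by (intro computes.intros(4)[where ys = "[n, c]"]) auto
    with n show "\<exists>n. P c n \<and> computes (Compose f [Minimize p, Proj 0]) [c] (F c n)" by blast
  qed
qed

section \<open>Construction of the transducer\<close>

text \<open>Runs of a sequential letter-to-letter machine with states in \<open>nat\<close> and initial state 0:
  the current state, followed by the outputs in reverse order.\<close>

definition seq_run :: "(nat \<Rightarrow> 'a \<Rightarrow> nat) \<Rightarrow> (nat \<Rightarrow> 'a \<Rightarrow> nat) \<Rightarrow> 'a list \<Rightarrow> nat list" where
  "seq_run nx ot u = fold (\<lambda>a s. nx (hd0 s) a # ot (hd0 s) a # tl s) u [0]"

text \<open>The complete output in reverse order, with the final letter in place of the state.
  Equality of outputs is not affected by the reversal, which \<open>realizes_m_output\<close>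
  undoes.\<close>

definition seq_output ::
  "(nat \<Rightarrow> 'a \<Rightarrow> nat) \<Rightarrow> (nat \<Rightarrow> 'a \<Rightarrow> nat) \<Rightarrow> (nat \<Rightarrow> nat) \<Rightarrow> 'a list \<Rightarrow> nat list" where
  "seq_output nx ot ft u = ft (hd0 (seq_run nx ot u)) # tl (seq_run nx ot u)"

lemma seq_run_Nil [simp]: "seq_run nx ot [] = [0]"
  by (simp add: seq_run_def)

lemma seq_run_snoc [simp]:
  "seq_run nx ot (u @ [a]) =
     nx (hd0 (seq_run nx ot u)) a # ot (hd0 (seq_run nx ot u)) a # tl (seq_run nx ot u)"
  by (simp add: seq_run_def)

definition residual ::
  "'a set \<Rightarrow> ('a list \<times> 'a list) set \<Rightarrow> 'a list \<Rightarrow> 'a list \<Rightarrow> ('a list \<times> 'a list) set" where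
  "residual A R u v = {(w, z). w \<in> lists A \<and> z \<in> lists A \<and> (u @ w, v @ z) \<in> R}"

lemma length_preservingD: "length_preserving R \<Longrightarrow> (u, v) \<in> R \<Longrightarrow> length u = length v"
  by (auto simp: length_preserving_def)

text \<open>Finite index appears in the form in which it is applied: a bound on finite sets of words
  that are pairwise \<open>E\<close>-related and pairwise not \<open>S\<close>-related. The
  transducer for R is represented by the finiteness of the set of residuals.\<close>

locale finite_index_equiv =
  fixes A :: "'a set" and R :: "('a list \<times> 'a list) set" and k :: nat
    and S E :: "('a list \<times> 'a list) set"
  defines "S \<equiv> syntactic_congruence A R"
    and "E \<equiv> (prefix_closure A R)\<^sup>+"
  assumes finite_A: "finite A"
    and equiv_R: "equiv (lists A) R"
    and lp: "length_preserving R"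
    and index: "\<And>D. finite D \<Longrightarrow> (\<And>x y. x \<in> D \<Longrightarrow> y \<in> D \<Longrightarrow> (x, y) \<in> E \<and> ((x, y) \<in> S \<longrightarrow> x = y)) \<Longrightarrow>
      card D \<le> k"
    and finite_residuals:
      "finite ((\<lambda>(u, v). residual A R u v) ` {(u, v). u \<in> lists A \<and> v \<in> lists A \<and> length u = length v})"
begin

abbreviation "P \<equiv> prefix_closure A R"
abbreviation "\<theta> \<equiv> residual A R"

section \<open>Basic properties of R, its syntactic congruence, its prefix closure and E\<close>

lemma R_lists: "(u, v) \<in> R \<Longrightarrow> u \<in> lists A \<and> v \<in> lists A"
  using equiv_R by (auto simp: equiv_def refl_on_def)
lemma R_refl: "u \<in> lists A \<Longrightarrow> (u, u) \<in> R"
  using equiv_R by (auto simp: equiv_def refl_on_def)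
lemma R_sym: "(u, v) \<in> R \<Longrightarrow> (v, u) \<in> R"
  using equiv_R by (auto simp: equiv_def sym_def)
lemma R_trans: "(u, v) \<in> R \<Longrightarrow> (v, w) \<in> R \<Longrightarrow> (u, w) \<in> R"
  using equiv_R by (auto simp: equiv_def trans_def)

lemma S_lists: "(u, v) \<in> S \<Longrightarrow> u \<in> lists A \<and> v \<in> lists A"
  by (auto simp: S_def syntactic_congruence_def)
lemma S_refl: "u \<in> lists A \<Longrightarrow> (u, u) \<in> S"
  by (auto simp: S_def syntactic_congruence_def intro!: R_refl)
lemma S_sym: "(u, v) \<in> S \<Longrightarrow> (v, u) \<in> S"
  by (auto simp: S_def syntactic_congruence_def intro: R_sym)
lemma S_trans: "(u, v) \<in> S \<Longrightarrow> (v, w) \<in> S \<Longrightarrow> (u, w) \<in> S"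
  unfolding S_def syntactic_congruence_def by (blast intro: R_trans)
lemma S_append: "(u, v) \<in> S \<Longrightarrow> w \<in> lists A \<Longrightarrow> (u @ w, v @ w) \<in> S"
  unfolding S_def syntactic_congruence_def by auto
lemma S_imp_R: "(u, v) \<in> S \<Longrightarrow> w \<in> lists A \<Longrightarrow> (u @ w, v @ w) \<in> R"
  unfolding S_def syntactic_congruence_def by auto

lemma R_imp_P: "(u, v) \<in> R \<Longrightarrow> (u, v) \<in> P"
  using R_lists[of u v] by (auto simp: prefix_closure_def intro!: bexI[of _ "[]"])
lemma P_lists: "(u, v) \<in> P \<Longrightarrow> u \<in> lists A \<and> v \<in> lists A"
  by (auto simp: prefix_closure_def)
lemma P_length: "(u, v) \<in> P \<Longrightarrow> length u = length v"
  using length_preservingD[OF lp] unfolding prefix_closure_def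
  by clarify (metis add_right_cancel length_append)
text \<open>The last letters move to the front of the continuations, which stay equally
  long.\<close>

lemma P_snocD:
  assumes "(u @ [a], v @ [b]) \<in> P"
  shows "(u, v) \<in> P"
proof -
  obtain x z where "x \<in> lists A" "z \<in> lists A" "length x = length z" "((u @ [a]) @ x, (v @ [b]) @ z) \<in> R"
    using assms by (auto simp: prefix_closure_def)
  moreover have "u \<in> lists A" "v \<in> lists A" "a \<in> A" "b \<in> A"
    using assms by (auto simp: prefix_closure_def)
  ultimately have "a # x \<in> lists A" "b # z \<in> lists A" "length (a # x) = length (b # z)"
    "(u @ a # x, v @ b # z) \<in> R" by auto
  with \<open>u \<in> lists A\<close> \<open>v \<in> lists A\<close> show ?thesis unfolding prefix_closure_def by blast
qed
lemma sym_P: "sym P"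
  unfolding sym_def prefix_closure_def by clarsimp (metis R_sym in_listsI)

lemma S_imp_E: "(u, v) \<in> S \<Longrightarrow> (u, v) \<in> E"
  using S_imp_R[of u v "[]"] R_imp_P by (auto simp: E_def)
lemma R_imp_E: "(u, v) \<in> R \<Longrightarrow> (u, v) \<in> E"
  using R_imp_P by (auto simp: E_def)
lemma E_refl: "u \<in> lists A \<Longrightarrow> (u, u) \<in> E"
  by (intro R_imp_E R_refl)
lemma E_sym: "(u, v) \<in> E \<Longrightarrow> (v, u) \<in> E"
  using sym_trancl[OF sym_P] by (auto simp: E_def sym_def)
lemma E_trans: "(u, v) \<in> E \<Longrightarrow> (v, w) \<in> E \<Longrightarrow> (u, w) \<in> E"
  by (auto simp: E_def)
lemma E_length: "(u, v) \<in> E \<Longrightarrow> length u = length v"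
  unfolding E_def by (induction rule: trancl_induct) (auto dest: P_length)
lemma E_lists: "(u, v) \<in> E \<Longrightarrow> u \<in> lists A \<and> v \<in> lists A"
  unfolding E_def by (induction rule: trancl_induct) (auto dest: P_lists)

text \<open>All words of a \<open>P\<close>-chain have the same length, so each intermediate word
  has a last letter, and \<open>P_snocD\<close> applies to every link.\<close>

lemma E_snocD: "(u @ [a], v @ [b]) \<in> E \<Longrightarrow> (u, v) \<in> E"
proof -
  have "(u @ [a], w) \<in> E \<Longrightarrow> \<forall>v b. w = v @ [b] \<longrightarrow> (u, v) \<in> E" for w
    unfolding E_def
  proof (induction rule: trancl_induct)
    case (base y)
    then show ?case using P_snocD by blast
  next
    case (step y z)
    then show ?case using P_length
      by (metis E_def P_snocD append_butlast_last_id length_0_conv list.distinct(1)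
          append_is_Nil_conv trancl_into_trancl)
  qed
  then show "(u @ [a], v @ [b]) \<in> E \<Longrightarrow> (u, v) \<in> E" by blast
qed

lemma E_snoc_cases:
  assumes "(w, u @ [a]) \<in> E"
  obtains v b where "w = v @ [b]" "(v, u) \<in> E" "b \<in> A" "v \<in> lists A"
proof -
  have "w \<noteq> []" using E_length[OF assms] by auto
  then obtain v b where "w = v @ [b]" by (metis append_butlast_last_id)
  with that show ?thesis using E_snocD assms E_lists[OF assms] by auto
qed

subsection \<open>Numbering the S-classes inside an E-class\<close>

text \<open>\<open>inj_choice\<close> depends only on the family to be numbered; this keeps the numbering finite-state.\<close>

definition inj_choice :: "(nat \<times> 'a) set set \<Rightarrow> (nat \<times> 'a) set \<Rightarrow> nat" where
  "inj_choice \<X> = (SOME g. inj_on g \<X> \<and> g ` \<X> \<subseteq> {..<k})"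

text \<open>Recursion on the length, since a class is described by the numbers of words that are one
  letter shorter: the pairs (number of x, c) with \<open>x @ [c]\<close> in the class. Inside one
  \<open>E\<close>-class this description identifies the \<open>S\<close>-class.\<close>

primrec numbering :: "nat \<Rightarrow> 'a list \<Rightarrow> nat" where
  "numbering 0 = (\<lambda>_. 0)"
| "numbering (Suc n) = (\<lambda>w. inj_choice
     ((\<lambda>w. {(numbering n x, c) | x c. (x @ [c], w) \<in> S}) ` (E `` {w}))
     {(numbering n x, c) | x c. (x @ [c], w) \<in> S})"

definition num :: "'a list \<Rightarrow> nat" where
  "num w = numbering (length w) w"

definition preds :: "'a list \<Rightarrow> (nat \<times> 'a) set" where
  "preds w = {(num x, c) | x c. (x @ [c], w) \<in> S}"

text \<open>Besides being the family that gets numbered, this set of sets is the letter that the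
  machine outputs on reaching w.\<close>

definition sibs :: "'a list \<Rightarrow> (nat \<times> 'a) set set" where
  "sibs w = preds ` (E `` {w})"

lemma num_Nil [simp]: "num [] = 0"
  by (simp add: num_def)

lemma num_snoc: "num (u @ [a]) = inj_choice (sibs (u @ [a])) (preds (u @ [a]))"
proof -
  have *: "{(numbering (length u) x, c) | x c. (x @ [c], w) \<in> S} = preds w"
    if "length w = Suc (length u)" for w
    unfolding preds_def num_def using that E_length[OF S_imp_E]
    by (intro Collect_cong) (metis length_append_singleton nat.inject)
  show ?thesis
    unfolding num_def sibs_def using * by (simp add: E_length[symmetric] cong: image_cong_simp)
qed

lemma preds_S: "(u, v) \<in> S \<Longrightarrow> preds u = preds v"
  unfolding preds_def using S_trans S_sym by blast

lemma sibs_E: "(u, v) \<in> E \<Longrightarrow> sibs u = sibs v"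
  unfolding sibs_def using E_trans E_sym by blast

text \<open>Choosing one word for each member of the family gives words that are pairwise not
  \<open>S\<close>-related, as \<open>S\<close>-related words have equal \<open>preds\<close>. Hence
  the index bounds the size of the family.\<close>

lemma inj_choice:
  assumes "w \<in> lists A"
    and inj: "\<And>u v. (u, w) \<in> E \<Longrightarrow> (v, w) \<in> E \<Longrightarrow> preds u = preds v \<Longrightarrow> (u, v) \<in> S"
  shows "inj_on (inj_choice (sibs w)) (sibs w)" "inj_choice (sibs w) ` sibs w \<subseteq> {..<k}"
proof -
  have "card \<Y> \<le> k" if "finite \<Y>" "\<Y> \<subseteq> sibs w" for \<Y>
  proof -
    obtain D where D: "D \<subseteq> E `` {w}" "inj_on preds D" "\<Y> = preds ` D"
      using \<open>\<Y> \<subseteq> sibs w\<close> unfolding sibs_def subset_image_inj by blast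
    have "(x, y) \<in> E \<and> ((x, y) \<in> S \<longrightarrow> x = y)" if "x \<in> D" "y \<in> D" for x y
      using that D by (meson E_sym E_trans Image_singleton_iff inj_onD preds_S subsetD)
    then show ?thesis
      using index[of D] D that card_image finite_image_iff by metis
  qed
  then have "finite (sibs w)" "card (sibs w) \<le> k"
    by (metis infinite_arbitrarily_large Suc_n_not_le_n, metis infinite_arbitrarily_large
        Suc_n_not_le_n order_refl)
  then have "\<exists>g. inj_on g (sibs w) \<and> g ` sibs w \<subseteq> {..<k}"
    using card_le_inj[of "sibs w" "{..<k}"] by auto
  from someI_ex[OF this] show
    "inj_on (inj_choice (sibs w)) (sibs w)" "inj_choice (sibs w) ` sibs w \<subseteq> {..<k}"
    unfolding inj_choice_def by blast+
qed

lemma k_pos: "0 < k"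
  using index[of "{[]}"] E_refl[of "[]"] by auto

text \<open>Induction on the length. If the predecessor sets of x and y share a pair (i, b), the two
  shorter words of number i are \<open>E\<close>-related because \<open>E\<close> is prefix-closed,
  hence \<open>S\<close>-related by induction, and appending b puts x and y into one
  \<open>S\<close>-class. So different classes have different predecessor sets, which the injective
  choice keeps apart.\<close>

lemma num_properties:
  "(u, v) \<in> E \<Longrightarrow> num u < k \<and> (num u = num v \<longleftrightarrow> (u, v) \<in> S)"
proof (induction "length u" arbitrary: u v)
  case 0
  then show ?case using E_length[OF 0(2)] k_pos S_refl[of "[]"] by simp
next
  case (Suc n)
  from Suc.hyps obtain u1 a where u: "u = u1 @ [a]"
    by (metis append_butlast_last_id length_0_conv nat.distinct(1))
  have inj: "(x, y) \<in> S" if xy: "(x, u) \<in> E" "(y, u) \<in> E" "preds x = preds y" for x y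
  proof -
    from xy(1) u obtain x1 b where x: "x = x1 @ [b]" "(x1, u1) \<in> E" by (metis E_snoc_cases)
    have "(num x1, b) \<in> preds x"
      unfolding preds_def x using S_refl E_lists xy(1) x by blast
    then obtain z where z: "num z = num x1" "(z @ [b], y) \<in> S"
      unfolding xy(3) by (auto simp: preds_def)
    have "(z @ [b], x1 @ [b]) \<in> E" using S_imp_E[OF z(2)] xy x E_trans E_sym by blast
    then have "(z, x1) \<in> E" by (rule E_snocD)
    moreover have "n = length z"
      using E_length[OF x(2)] E_length[OF calculation] Suc.hyps(2) u by simp
    ultimately have "(z, x1) \<in> S" using Suc.hyps(1)[of z x1] z by blast
    then have "(z @ [b], x) \<in> S"
      unfolding x(1) using E_lists[OF xy(1)] x by (intro S_append) auto
    with z show "(x, y) \<in> S" using S_trans S_sym by blast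
  qed
  have ul: "u \<in> lists A" using E_lists Suc.prems by blast
  have ic: "inj_on (inj_choice (sibs u)) (sibs u)" "inj_choice (sibs u) ` sibs u \<subseteq> {..<k}"
    by (rule inj_choice[OF ul], rule inj, assumption+)+
  from Suc.prems obtain v1 b where v: "v = v1 @ [b]" using u E_sym by (metis E_snoc_cases)
  have nv: "num v = inj_choice (sibs u) (preds v)"
    using sibs_E[OF Suc.prems] by (simp add: v num_snoc)
  have nu: "num u = inj_choice (sibs u) (preds u)" by (simp add: u num_snoc)
  have mem: "preds u \<in> sibs u" "preds v \<in> sibs u"
    using E_refl[OF ul] Suc.prems by (auto simp: sibs_def)
  have "num u = num v \<longleftrightarrow> preds u = preds v"
    using inj_onD[OF ic(1)] mem nu nv by metis
  also have "\<dots> \<longleftrightarrow> (u, v) \<in> S"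
    using inj[of u v] E_sym[OF Suc.prems] E_refl[OF ul] preds_S by blast
  finally have "num u = num v \<longleftrightarrow> (u, v) \<in> S" .
  moreover have "num u < k"
    unfolding nu using ic(2) mem(1) by (auto simp only: image_subset_iff lessThan_iff)
  ultimately show ?case by blast
qed

lemma num_less: "u \<in> lists A \<Longrightarrow> num u < k"
  using num_properties E_refl by blast

subsection \<open>The states\<close>

text \<open>The residual matrix of the \<open>E\<close>-class as a set of triples; by
  \<open>num_properties\<close> and \<open>residual_S\<close>, each pair of numbers occurs with only
  one residual.\<close>

definition pattern :: "'a list \<Rightarrow> (nat \<times> nat \<times> ('a list \<times> 'a list) set) set" where
  "pattern u = {(num v, num w, \<theta> v w) | v w. (v, u) \<in> E \<and> (w, u) \<in> E}"

definition st :: "'a list \<Rightarrow> nat \<times> (nat \<times> nat \<times> ('a list \<times> 'a list) set) set" where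
  "st u = (num u, pattern u)"

text \<open>An R-class is a union of \<open>S\<close>-classes inside one \<open>E\<close>-class, so
  the numbers of these classes name it there.\<close>

definition final_class :: "'a list \<Rightarrow> nat set" where
  "final_class u = num ` (R `` {u})"

lemma residual_S: "(v, v') \<in> S \<Longrightarrow> (w, w') \<in> S \<Longrightarrow> \<theta> v w = \<theta> v' w'"
proof -
  have "\<theta> v w \<subseteq> \<theta> v' w'" if "(v, v') \<in> S" "(w, w') \<in> S" for v v' w w'
    using that unfolding residual_def
    by auto (meson R_sym R_trans S_imp_R in_listsI)
  then show "(v, v') \<in> S \<Longrightarrow> (w, w') \<in> S \<Longrightarrow> \<theta> v w = \<theta> v' w'"
    by (meson S_sym subset_antisym)
qed

section \<open>The state determines the state after the next letter\<close>

lemma residual_snoc: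
  "b \<in> A \<Longrightarrow> c \<in> A \<Longrightarrow> \<theta> (v @ [b]) (w @ [c]) = {(x, z). (b # x, c # z) \<in> \<theta> v w}"
  by (auto simp: residual_def)

text \<open>With \<open>residual_S_iff\<close>, this makes \<open>P\<close> and \<open>S\<close>
  readable from the matrix: some equally long pair in the residual means \<open>P\<close>, the whole
  diagonal means \<open>S\<close>. By \<open>residual_snoc\<close> the same holds after one more
  letter.\<close>

lemma residual_P_iff:
  "v \<in> lists A \<Longrightarrow> w \<in> lists A \<Longrightarrow> (v, w) \<in> P \<longleftrightarrow> (\<exists>(x, z) \<in> \<theta> v w. length x = length z)"
  by (auto simp: prefix_closure_def residual_def)

lemma residual_S_iff:
  "v \<in> lists A \<Longrightarrow> w \<in> lists A \<Longrightarrow> (v, w) \<in> S \<longleftrightarrow> (\<forall>x \<in> lists A. (x, x) \<in> \<theta> v w)"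
  by (auto simp: S_def syntactic_congruence_def residual_def)

text \<open>Matches the words in the \<open>E\<close>-classes of u and u' by the numbers of their
  \<open>S\<close>-classes. If the patterns agree, all data about the children of one
  \<open>E\<close>-class carry over to the other along this matching.\<close>

definition corr :: "'a list \<Rightarrow> 'a list \<Rightarrow> 'a list \<Rightarrow> 'a list \<Rightarrow> bool" where
  "corr u u' v v' \<longleftrightarrow> (v, u) \<in> E \<and> (v', u') \<in> E \<and> num v = num v'"

lemma corr_sym: "corr u u' v v' \<Longrightarrow> corr u' u v' v"
  by (auto simp: corr_def)

lemma corr_lists: "corr u u' v v' \<Longrightarrow> v \<in> lists A \<and> v' \<in> lists A"
  using E_lists by (auto simp: corr_def)

text \<open>The diagonal entry of v in the pattern shows that its number is also used in the class
  of u'.\<close>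

lemma corr_ex:
  assumes "pattern u = pattern u'" "(v, u) \<in> E"
  obtains v' where "corr u u' v v'"
proof -
  have "(num v, num v, \<theta> v v) \<in> pattern u'"
    using assms(2) unfolding assms(1)[symmetric] by (auto simp: pattern_def)
  then obtain v' where "num v' = num v" "(v', u') \<in> E" by (auto simp: pattern_def)
  then show ?thesis using that[of v'] assms(2) by (simp add: corr_def)
qed

lemma corr_residual:
  assumes "pattern u = pattern u'" "corr u u' v v'" "corr u u' w w'"
  shows "\<theta> v w = \<theta> v' w'"
proof -
  have "(num v, num w, \<theta> v w) \<in> pattern u"
    using assms(2,3) unfolding pattern_def corr_def by blast
  then have "(num v, num w, \<theta> v w) \<in> pattern u'" by (simp add: assms(1))
  then obtain y z where yz: "num y = num v" "num z = num w" "\<theta> v w = \<theta> y z" "(y, u') \<in> E" "(z, u') \<in> E"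
    by (auto simp: pattern_def)
  have "(y, v') \<in> S" if "(y, u') \<in> E" "num y = num v" "corr u u' v v'" for y v v'
    using that num_properties[of y v'] E_trans[of y u' v'] E_sym[of v' u'] by (auto simp: corr_def)
  then have "(y, v') \<in> S" "(z, w') \<in> S" using yz assms(2,3) by blast+
  then show ?thesis using residual_S[of y v' z w'] yz(3) by simp
qed

context
  fixes u u'
  assumes pat: "pattern u = pattern u'"
begin

lemma corr_residual_snoc:
  "corr u u' v v' \<Longrightarrow> corr u u' w w' \<Longrightarrow> b \<in> A \<Longrightarrow> c \<in> A \<Longrightarrow>
     \<theta> (v @ [b]) (w @ [c]) = \<theta> (v' @ [b]) (w' @ [c])"
  by (simp add: residual_snoc corr_residual[OF pat])

lemma corr_P:
  "corr u u' v v' \<Longrightarrow> corr u u' w w' \<Longrightarrow> (v @ [b], w @ [c]) \<in> P \<Longrightarrow> (v' @ [b], w' @ [c]) \<in> P"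
  using P_lists[of "v @ [b]" "w @ [c]"] corr_lists[of u u' v v'] corr_lists[of u u' w w']
    corr_residual_snoc[of v v' w w' b c] residual_P_iff[of "v @ [b]" "w @ [c]"]
    residual_P_iff[of "v' @ [b]" "w' @ [c]"]
  by simp

lemma corr_S:
  "corr u u' v v' \<Longrightarrow> corr u u' w w' \<Longrightarrow> (v @ [b], w @ [c]) \<in> S \<Longrightarrow> (v' @ [b], w' @ [c]) \<in> S"
  using S_lists[of "v @ [b]" "w @ [c]"] corr_lists[of u u' v v'] corr_lists[of u u' w w']
    corr_residual_snoc[of v v' w w' b c] residual_S_iff[of "v @ [b]" "w @ [c]"]
    residual_S_iff[of "v' @ [b]" "w' @ [c]"]
  by simp

text \<open>A \<open>P\<close>-chain between children carries over link by link: each intermediate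
  word extends a word in the \<open>E\<close>-class of u, which has a counterpart, and each link is
  decided by a residual.\<close>

lemma corr_E:
  assumes v: "corr u u' v v'" and w: "corr u u' w w'" and E: "(v @ [b], w @ [c]) \<in> E"
  shows "(v' @ [b], w' @ [c]) \<in> E"
proof -
  have "(v @ [b], y) \<in> P\<^sup>+ \<Longrightarrow> \<forall>w w' c. y = w @ [c] \<longrightarrow> corr u u' w w' \<longrightarrow> (v' @ [b], w' @ [c]) \<in> E" for y
  proof (induction rule: trancl_induct)
    case (base y)
    then show ?case using corr_P[OF v] by (auto simp: E_def)
  next
    case (step y z)
    show ?case
    proof (intro allI impI)
      fix w w' c assume z: "z = w @ [c]" and w: "corr u u' w w'"
      have "(y, w @ [c]) \<in> E" using step(2) z by (auto simp: E_def)
      then obtain w1 c1 where y: "y = w1 @ [c1]" "(w1, w) \<in> E" by (rule E_snoc_cases)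
      then have "(w1, u) \<in> E" using w E_trans by (auto simp: corr_def)
      then obtain w1' where w1': "corr u u' w1 w1'" by (rule corr_ex[OF pat])
      have "(v' @ [b], w1' @ [c1]) \<in> E" using step.IH y w1' by blast
      moreover have "(w1' @ [c1], w' @ [c]) \<in> E"
        using corr_P[OF w1' w] step(2) y z by (auto simp: E_def)
      ultimately show "(v' @ [b], w' @ [c]) \<in> E" by (rule E_trans)
    qed
  qed
  then show ?thesis using w E by (auto simp: E_def)
qed

lemma corr_preds_subset:
  assumes v: "corr u u' v v'"
  shows "preds (v @ [b]) \<subseteq> preds (v' @ [b])"
proof
  fix p assume "p \<in> preds (v @ [b])"
  then obtain x c where p: "p = (num x, c)" "(x @ [c], v @ [b]) \<in> S" by (auto simp: preds_def)
  have "(x, u) \<in> E" using E_snocD S_imp_E p v E_trans by (meson corr_def)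
  then obtain x' where x': "corr u u' x x'" by (rule corr_ex[OF pat])
  then show "p \<in> preds (v' @ [b])"
    using corr_S[OF x' v p(2)] p by (auto simp: preds_def corr_def)
qed

end

lemma corr_preds:
  "pattern u = pattern u' \<Longrightarrow> corr u u' v v' \<Longrightarrow> preds (v @ [b]) = preds (v' @ [b])"
  using corr_preds_subset[of u u' v v'] corr_preds_subset[of u' u v' v] corr_sym[of u u' v v']
  by (intro subset_antisym) simp_all

lemma corr_sibs_subset:
  assumes pat: "pattern u = pattern u'" and v: "corr u u' v v'"
  shows "sibs (v @ [b]) \<subseteq> sibs (v' @ [b])"
proof
  fix X assume "X \<in> sibs (v @ [b])"
  then obtain w where w: "(w, v @ [b]) \<in> E" "X = preds w"
    by (auto simp: sibs_def dest: E_sym)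
  then obtain y c where y: "w = y @ [c]" "(y, v) \<in> E" by (metis E_snoc_cases)
  then have "(y, u) \<in> E" using v E_trans by (auto simp: corr_def)
  then obtain y' where y': "corr u u' y y'" by (rule corr_ex[OF pat])
  have "(y' @ [c], v' @ [b]) \<in> E" using corr_E[OF pat y' v] w y by blast
  then show "X \<in> sibs (v' @ [b])"
    using corr_preds[OF pat y'] w y by (auto simp: sibs_def dest: E_sym)
qed

lemma corr_sibs:
  "pattern u = pattern u' \<Longrightarrow> corr u u' v v' \<Longrightarrow> sibs (v @ [b]) = sibs (v' @ [b])"
  using corr_sibs_subset[of u u' v v'] corr_sibs_subset[of u' u v' v] corr_sym[of u u' v v']
  by (intro subset_antisym) simp_all

text \<open>Here it pays off that \<open>inj_choice\<close> is a function of the family alone: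
  corresponding children are the same member of the same family.\<close>

lemma corr_num:
  "pattern u = pattern u' \<Longrightarrow> corr u u' v v' \<Longrightarrow> num (v @ [b]) = num (v' @ [b])"
  by (simp add: num_snoc corr_sibs corr_preds)

lemma st_corr:
  "st u = st u' \<Longrightarrow> u \<in> lists A \<Longrightarrow> u' \<in> lists A \<Longrightarrow> pattern u = pattern u' \<and> corr u u' u u'"
  by (auto simp: st_def corr_def E_refl)

lemma pattern_snoc_subset:
  assumes pat: "pattern u = pattern u'" and u: "corr u u' u u'"
  shows "pattern (u @ [a]) \<subseteq> pattern (u' @ [a])"
proof
  fix p assume "p \<in> pattern (u @ [a])"
  then obtain x y where p: "p = (num x, num y, \<theta> x y)" and xy: "(x, u @ [a]) \<in> E" "(y, u @ [a]) \<in> E"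
    by (auto simp: pattern_def)
  obtain v b where x: "x = v @ [b]" "(v, u) \<in> E" "b \<in> A" using xy by (metis E_snoc_cases)
  obtain w c where y: "y = w @ [c]" "(w, u) \<in> E" "c \<in> A" using xy by (metis E_snoc_cases)
  obtain v' where v': "corr u u' v v'" using x by (metis corr_ex[OF pat])
  obtain w' where w': "corr u u' w w'" using y by (metis corr_ex[OF pat])
  have "p = (num (v' @ [b]), num (w' @ [c]), \<theta> (v' @ [b]) (w' @ [c]))"
    using p x y corr_num[OF pat v'] corr_num[OF pat w'] corr_residual_snoc[OF pat v' w'] by simp
  then show "p \<in> pattern (u' @ [a])"
    unfolding pattern_def using corr_E[OF pat v' u] corr_E[OF pat w' u] xy x y by blast
qed

text \<open>Needed to define the transition and output functions on states through representative
  words.\<close>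

lemma st_snoc:
  assumes "st u = st u'" "u \<in> lists A" "u' \<in> lists A"
  shows "st (u @ [a]) = st (u' @ [a])" "sibs (u @ [a]) = sibs (u' @ [a])"
  using st_corr[OF assms] pattern_snoc_subset[of u u'] pattern_snoc_subset[of u' u]
    corr_num corr_sibs corr_sym
  by (auto simp: st_def)

lemma final_class_subset:
  assumes "st u = st u'" "u \<in> lists A" "u' \<in> lists A"
  shows "final_class u \<subseteq> final_class u'"
proof
  fix i assume "i \<in> final_class u"
  then obtain v where v: "i = num v" "(v, u) \<in> R" by (auto simp: final_class_def dest: R_sym)
  note pat = st_corr[OF assms]
  obtain v' where v': "corr u u' v v'" using R_imp_E[OF v(2)] pat by (metis corr_ex)
  \<comment> \<open>R itself is visible in the matrix: it holds if and only if the residual contains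
    the pair of empty words.\<close>
  have "([], []) \<in> \<theta> v u" using v by (simp add: residual_def)
  then have "([], []) \<in> \<theta> v' u'" using corr_residual[of u u' v v' u u'] v' pat by simp
  then have "(v', u') \<in> R" by (simp add: residual_def)
  then show "i \<in> final_class u'" using v v' by (auto simp: final_class_def corr_def dest: R_sym)
qed

lemma final_class_st:
  "st u = st u' \<Longrightarrow> u \<in> lists A \<Longrightarrow> u' \<in> lists A \<Longrightarrow> final_class u = final_class u'"
  by (metis final_class_subset subset_antisym)

subsection \<open>The outputs\<close>

definition outs :: "'a list \<Rightarrow> (nat \<times> 'a) set set list" where
  "outs u = map (\<lambda>i. sibs (take (Suc i) u)) [0..<length u]"

lemma outs_Nil [simp]: "outs [] = []"
  by (simp add: outs_def)

lemma outs_snoc [simp]: "outs (u @ [a]) = outs u @ [sibs (u @ [a])]"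
  by (simp add: outs_def)

text \<open>A single letter \<open>sibs w\<close> does not in general determine the
  \<open>E\<close>-class, as numbers are meaningful only inside one \<open>E\<close>-class. Among
  the children of a common class it does: a word of number \<open>num u\<close> found through the
  pair \<open>(num u, a)\<close> lies in the class of u, so it is \<open>S\<close>-related to u, and
  appending a leads into the class of the other child.\<close>

lemma outs_eq_iff: "u \<in> lists A \<Longrightarrow> v \<in> lists A \<Longrightarrow> outs u = outs v \<longleftrightarrow> (u, v) \<in> E"
proof (induction u arbitrary: v rule: rev_induct)
  case Nil
  then show ?case using E_length[of "[]" v] E_refl[of "[]"] by (cases v rule: rev_cases) auto
next
  case (snoc a u)
  show ?case
  proof (cases v rule: rev_cases)
    case Nil
    then show ?thesis using E_length[of "u @ [a]" "[]"] by auto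
  next
    case (snoc w b)
    have l: "u \<in> lists A" "w \<in> lists A" "a \<in> A" "b \<in> A" using snoc.prems snoc by auto
    have "(u @ [a], w @ [b]) \<in> E" if *: "outs u = outs w" "sibs (u @ [a]) = sibs (w @ [b])"
    proof -
      have uw: "(u, w) \<in> E" using snoc.IH[of w] l * by simp
      have "preds (u @ [a]) \<in> sibs (w @ [b])"
        unfolding *(2)[symmetric] unfolding sibs_def using E_refl[OF snoc.prems(1)] by (intro imageI) simp
      then obtain x where x: "(x, w @ [b]) \<in> E" "preds (u @ [a]) = preds x"
        by (auto simp: sibs_def dest: E_sym)
      have "(num u, a) \<in> preds (u @ [a])"
        unfolding preds_def using S_refl[OF snoc.prems(1)] by blast
      then obtain z where z: "num z = num u" "(z @ [a], x) \<in> S"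
        unfolding x(2) by (auto simp: preds_def)
      have zE: "(z @ [a], w @ [b]) \<in> E" using E_trans[OF S_imp_E[OF z(2)] x(1)] .
      then have "(z, u) \<in> E" using E_trans[OF E_snocD[OF zE] E_sym[OF uw]] by blast
      then have "(z, u) \<in> S" using num_properties z by blast
      then have "(z @ [a], u @ [a]) \<in> S" using l by (intro S_append) auto
      then show ?thesis using E_trans[OF E_sym[OF S_imp_E] zE] by blast
    qed
    moreover have "outs u = outs w \<and> sibs (u @ [a]) = sibs (w @ [b])" if "(u @ [a], w @ [b]) \<in> E"
      using that sibs_E[OF that] snoc.IH[of w] l E_snocD[OF that] by simp
    ultimately show ?thesis using snoc by auto
  qed
qed

text \<open>Equal letters put u and v into one \<open>E\<close>-class; if also the final classes
  agree, the number of u is that of some word R-related to v, and this word is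
  \<open>S\<close>-related to u.\<close>

lemma R_iff_outs:
  assumes "u \<in> lists A" "v \<in> lists A"
  shows "(u, v) \<in> R \<longleftrightarrow> outs u = outs v \<and> final_class u = final_class v"
proof
  assume *: "(u, v) \<in> R"
  then have "R `` {u} = R `` {v}" using R_sym R_trans by blast
  with * show "outs u = outs v \<and> final_class u = final_class v"
    using R_imp_E outs_eq_iff[OF assms] by (simp add: final_class_def)
next
  assume *: "outs u = outs v \<and> final_class u = final_class v"
  then have uv: "(u, v) \<in> E" using outs_eq_iff[OF assms] by blast
  have "num u \<in> final_class u" using R_refl[OF assms(1)] by (auto simp: final_class_def)
  then have "num u \<in> final_class v" using * by simp
  then obtain x where x: "num x = num u" "(v, x) \<in> R" by (auto simp: final_class_def)
  then have "(x, u) \<in> E" using R_imp_E uv E_sym E_trans by blast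
  then have "(x, u) \<in> S" using num_properties x by blast
  then show "(u, v) \<in> R" using S_imp_R[of x u "[]"] x R_trans R_sym by (metis append_Nil2 lists.Nil)
qed

lemma finite_st: "finite (st ` lists A)"
proof (rule finite_subset)
  let ?\<Theta> = "(\<lambda>(u, v). \<theta> u v) ` {(u, v). u \<in> lists A \<and> v \<in> lists A \<and> length u = length v}"
  show "st ` lists A \<subseteq> {..<k} \<times> Pow ({..<k} \<times> {..<k} \<times> ?\<Theta>)"
  proof (rule image_subsetI)
    fix u assume u: "u \<in> lists A"
    have "pattern u \<subseteq> {..<k} \<times> {..<k} \<times> ?\<Theta>"
    proof
      fix q assume "q \<in> pattern u"
      then obtain v w where q: "q = (num v, num w, \<theta> v w)" "(v, u) \<in> E" "(w, u) \<in> E"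
        by (auto simp: pattern_def)
      have vw: "v \<in> lists A" "w \<in> lists A" "length v = length w"
        using E_lists[OF q(2)] E_lists[OF q(3)] E_length[OF q(2)] E_length[OF q(3)] by simp_all
      then have "\<theta> v w \<in> ?\<Theta>" by (intro image_eqI[of _ _ "(v, w)"]) simp_all
      then show "q \<in> {..<k} \<times> {..<k} \<times> ?\<Theta>"
        using num_less vw q(1) by simp
    qed
    then show "st u \<in> {..<k} \<times> Pow ({..<k} \<times> {..<k} \<times> ?\<Theta>)"
      using u num_less[of u] by (simp add: st_def)
  qed
  show "finite ({..<k} \<times> Pow ({..<k} \<times> {..<k} \<times> ?\<Theta>))"
    using finite_residuals by simp
qed

lemma finite_sibs: "finite (sibs ` lists A)"
proof (rule finite_subset)
  have "preds w \<subseteq> {..<k} \<times> A" for w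
    using S_lists num_less by (fastforce simp: preds_def)
  then show "sibs ` lists A \<subseteq> Pow (Pow ({..<k} \<times> A))" by (auto simp: sibs_def)
qed (simp add: finite_A)

lemma finite_final_class: "finite (final_class ` lists A)"
  by (rule finite_subset[of _ "Pow {..<k}"]) (auto simp: final_class_def num_less R_lists)

lemma machine_exists:
  "\<exists>n nx ot ft. 0 < n \<and> (\<forall>p a. nx p a < n) \<and>
     (\<forall>u \<in> lists A. \<forall>v \<in> lists A. seq_output nx ot ft u = seq_output nx ot ft v \<longleftrightarrow> (u, v) \<in> R)"
proof -
  obtain h m where h: "inj_on h (st ` lists A)" "h ` st ` lists A = {i::nat. i < m}"
    using finite_imp_inj_to_nat_seg[OF finite_st] by metis
  obtain g\<^sub>o :: "_ \<Rightarrow> nat" where g\<^sub>o: "inj_on g\<^sub>o (sibs ` lists A)"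
    using finite_imp_inj_to_nat_seg[OF finite_sibs] by metis
  obtain g\<^sub>t :: "_ \<Rightarrow> nat" where g\<^sub>t: "inj_on g\<^sub>t (final_class ` lists A)"
    using finite_imp_inj_to_nat_seg[OF finite_final_class] by metis
  \<comment> \<open>A run starts in state 0, so the state of the empty word is moved to 0 and the
    other numbers go up by one.\<close>
  define g where "g s = (if s = st [] then 0 else Suc (h s))" for s
  have g: "g (st u) = g (st v) \<longleftrightarrow> st u = st v" if "u \<in> lists A" "v \<in> lists A" for u v
    using that h(1) by (auto simp: g_def inj_on_def)
  have g_less: "g (st u) < Suc m" if "u \<in> lists A" for u
    using that h(2) by (auto simp: g_def)
  \<comment> \<open>A word leading to the state numbered p; the default makes the functions below
    total.\<close>
  define rep where "rep p = (if \<exists>u \<in> lists A. g (st u) = p then SOME u. u \<in> lists A \<and> g (st u) = p else [])"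
    for p
  have rep: "rep (g (st u)) \<in> lists A \<and> st (rep (g (st u))) = st u" if "u \<in> lists A" for u
  proof -
    have "\<exists>v. v \<in> lists A \<and> g (st v) = g (st u)" using that by blast
    from someI_ex[OF this] that show ?thesis unfolding rep_def using g by auto
  qed
  have rep_lists: "rep p \<in> lists A" for p
  proof (cases "\<exists>u \<in> lists A. g (st u) = p")
    case True
    then show ?thesis using rep by blast
  qed (simp add: rep_def)
  \<comment> \<open>Letters outside \<open>A\<close> lead to 0, so that \<open>nx\<close> stays
    below the bound on all arguments.\<close>
  define nx where "nx p a = (if a \<in> A then g (st (rep p @ [a])) else 0)" for p a
  define ot where "ot p a = g\<^sub>o (sibs (rep p @ [a]))" for p a
  define ft where "ft p = g\<^sub>t (final_class (rep p))" for p
  have run: "seq_run nx ot u = g (st u) # rev (map g\<^sub>o (outs u))" if "u \<in> lists A" for u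
    using that
  proof (induction u rule: rev_induct)
    case Nil
    then show ?case by (simp add: g_def)
  next
    case (snoc a u)
    then show ?case
      using rep[of u] st_snoc[of "rep (g (st u))" u a] by (simp add: nx_def ot_def)
  qed
  have "set (outs u) \<subseteq> sibs ` lists A" if "u \<in> lists A" for u
    using that by (auto simp: outs_def dest: in_set_takeD)
  then have outs: "map g\<^sub>o (outs u) = map g\<^sub>o (outs v) \<longleftrightarrow> outs u = outs v"
    if "u \<in> lists A" "v \<in> lists A" for u v
    using that by (intro inj_on_map_eq_map inj_on_subset[OF g\<^sub>o]) blast
  have "seq_output nx ot ft u = seq_output nx ot ft v \<longleftrightarrow> (u, v) \<in> R"
    if uv: "u \<in> lists A" "v \<in> lists A" for u v
  proof -
    have "final_class (rep (g (st u))) = final_class u" if "u \<in> lists A" for u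
      using final_class_st rep[OF that] that by blast
    then have "seq_output nx ot ft u = seq_output nx ot ft v \<longleftrightarrow>
        g\<^sub>t (final_class u) = g\<^sub>t (final_class v) \<and> outs u = outs v"
      using uv outs[of u v] by (simp add: seq_output_def run ft_def)
    also have "\<dots> \<longleftrightarrow> (u, v) \<in> R"
      using R_iff_outs uv inj_on_eq_iff[OF g\<^sub>t] by auto
    finally show ?thesis .
  qed
  moreover have "nx p a < Suc m" for p a
    using g_less rep_lists by (simp add: nx_def)
  ultimately show ?thesis by blast
qed

end

text \<open>The members of D lie in different \<open>S\<close>-classes, all contained in the
  \<open>T\<close>-class of any one of them, so D is counted by the supremum.\<close>

lemma relative_index_bound:
  assumes fin: "relative_index X S T < \<infinity>" and S: "equiv X S" and T: "equiv X T" and sub: "S \<subseteq> T"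
  obtains k where "\<And>D. finite D \<Longrightarrow> (\<And>x y. x \<in> D \<Longrightarrow> y \<in> D \<Longrightarrow> (x, y) \<in> T \<and> ((x, y) \<in> S \<longrightarrow> x = y)) \<Longrightarrow>
    card D \<le> k"
proof -
  obtain k where k: "relative_index X S T = enat k" using fin by (cases "relative_index X S T") auto
  have "card D \<le> k" if D: "finite D"
    "\<And>x y. x \<in> D \<Longrightarrow> y \<in> D \<Longrightarrow> (x, y) \<in> T \<and> ((x, y) \<in> S \<longrightarrow> x = y)" for D
  proof (cases "D = {}")
    case False
    then obtain d where d: "d \<in> D" by blast
    then have dX: "d \<in> X" using D(2) T by (auto simp: equiv_def refl_on_def)
    define \<D> where "\<D> = (\<lambda>x. S `` {x}) ` D"
    have DX: "D \<subseteq> X" using D(2) T by (auto simp: equiv_def refl_on_def)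
    have "inj_on (\<lambda>x. S `` {x}) D"
      using D(2) DX by (auto intro!: inj_onI simp: eq_equiv_class_iff[OF S] subset_iff)
    then have "card D = card \<D>" by (simp add: \<D>_def card_image)
    moreover have "S `` {x} \<in> X // S" "S `` {x} \<subseteq> T `` {d}" if "x \<in> D" for x
      using that D(2)[OF d that] DX sub T by (auto intro!: quotientI simp: equiv_def dest: transD)
    then have "finite \<D> \<and> \<D> \<subseteq> {D \<in> X // S. D \<subseteq> T `` {d}}" using D(1) by (auto simp: \<D>_def)
    then have "enat (card \<D>) \<le> (SUP \<D> \<in> {\<D>. finite \<D> \<and> \<D> \<subseteq> {D \<in> X // S. D \<subseteq> T `` {d}}}. enat (card \<D>))"
      by (intro SUP_upper) simp
    then have "enat (card \<D>) \<le> relative_index X S T"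
      unfolding relative_index_def using quotientI[OF dX, of T] by (meson SUP_upper2)
    ultimately show ?thesis using k by simp
  qed simp
  with that show ?thesis by blast
qed

theorem subsequential_machine_exists:
  fixes A :: "'a set"
  assumes "finite A" "equiv (lists A) R" "length_preserving R"
    and fin: "relative_index (lists A) (syntactic_congruence A R) ((prefix_closure A R)\<^sup>+) < \<infinity>"
    and "finite ((\<lambda>(u, v). residual A R u v) ` {(u, v). u \<in> lists A \<and> v \<in> lists A \<and> length u = length v})"
  shows "\<exists>n nx ot ft. 0 < n \<and> (\<forall>p a. nx p a < n) \<and>
     (\<forall>u \<in> lists A. \<forall>v \<in> lists A. seq_output nx ot ft u = seq_output nx ot ft v \<longleftrightarrow> (u, v) \<in> R)"
proof -
  let ?S = "syntactic_congruence A R" and ?P = "prefix_closure A R"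
  have R: "u \<in> lists A \<Longrightarrow> (u, u) \<in> R" "(u, v) \<in> R \<Longrightarrow> (v, u) \<in> R" "(u, v) \<in> R \<Longrightarrow> (v, w) \<in> R \<Longrightarrow> (u, w) \<in> R"
    "(u, v) \<in> R \<Longrightarrow> u \<in> lists A" "(u, v) \<in> R \<Longrightarrow> v \<in> lists A"
    for u v w using assms(2) by (auto simp: equiv_def refl_on_def dest: symD transD)
  have S: "equiv (lists A) ?S"
  proof (rule equivI)
    show "trans ?S"
    proof (rule transI)
      fix u v w assume "(u, v) \<in> ?S" "(v, w) \<in> ?S"
      then show "(u, w) \<in> ?S"
        unfolding syntactic_congruence_def using R(3)[of "u @ x" "v @ x" "w @ x" for x] by blast
    qed
    show "sym ?S" unfolding sym_def syntactic_congruence_def using R(2) by blast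
  qed (auto simp: syntactic_congruence_def refl_on_def intro!: R(1))
  have "?P \<subseteq> lists A \<times> lists A" by (auto simp: prefix_closure_def)
  then have sub: "?P\<^sup>+ \<subseteq> lists A \<times> lists A" by (rule trancl_subset_Sigma)
  have R_P: "R \<subseteq> ?P"
  proof (rule subrelI)
    fix u v assume "(u, v) \<in> R"
    then show "(u, v) \<in> ?P"
      using R(4,5)[of u v] by (auto simp: prefix_closure_def intro!: bexI[of _ "[]"])
  qed
  have "sym ?P" unfolding sym_def prefix_closure_def by clarsimp (metis R(2) in_listsI)
  then have E: "equiv (lists A) (?P\<^sup>+)"
  proof (intro equivI sym_trancl trans_trancl sub refl_onI)
    show "(u, u) \<in> ?P\<^sup>+" if "u \<in> lists A" for u
      using R(1)[OF that] R_P by blast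
  qed
  have "?S \<subseteq> R"
  proof (rule subrelI)
    fix u v assume "(u, v) \<in> ?S"
    then show "(u, v) \<in> R"
      unfolding syntactic_congruence_def by (auto dest: bspec[of _ _ "[]"])
  qed
  then have "?S \<subseteq> ?P\<^sup>+" using R_P by auto
  from relative_index_bound[OF fin S E this] obtain k where
    "\<And>D. finite D \<Longrightarrow> (\<And>x y. x \<in> D \<Longrightarrow> y \<in> D \<Longrightarrow> (x, y) \<in> ?P\<^sup>+ \<and> ((x, y) \<in> ?S \<longrightarrow> x = y)) \<Longrightarrow> card D \<le> k"
    by metis
  then interpret finite_index_equiv A R k ?S "?P\<^sup>+"
    using assms by unfold_locales auto
  show ?thesis by (rule machine_exists)
qed

section \<open>Short paths and residuals\<close>

text \<open>If the goodness of a list depends on a prefix only through its image under \<open>g\<close>, then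
  a shortest good list has prefixes with pairwise different images.\<close>

lemma short_good_list:
  assumes "finite X"
    and X: "\<And>xs i. good xs \<Longrightarrow> i \<le> length xs \<Longrightarrow> g (take i xs) \<in> X"
    and cut: "\<And>p p' s. g p = g p' \<Longrightarrow> good (p' @ s) \<Longrightarrow> good (p @ s)"
    and "good xs"
  shows "\<exists>ys. good ys \<and> length ys < card X"
proof -
  obtain ys where ys: "good ys" "\<And>zs. good zs \<Longrightarrow> length ys \<le> length zs"
    using ex_has_least_nat[of good xs length] \<open>good xs\<close> by blast
  have False if g: "g (take i ys) = g (take j ys)" and ij: "i < j" "j \<le> length ys" for i j
  proof -
    have "good (take i ys @ drop j ys)" using cut[OF g, of "drop j ys"] ys(1) by simp
    from ys(2)[OF this] ij show False by simp
  qed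
  then have "inj_on (\<lambda>i. g (take i ys)) {..length ys}"
    by (intro inj_onI) (metis atMost_iff linorder_neqE_nat)
  moreover have "(\<lambda>i. g (take i ys)) ` {..length ys} \<subseteq> X" using X[OF ys(1)] by auto
  ultimately have "card {..length ys} \<le> card X" using card_inj_on_le \<open>finite X\<close> by blast
  then show ?thesis using ys(1) by auto
qed

text \<open>The state reached by a sequence of transitions, as a list with at most one element:
  the list is empty if the transitions do not form a path.\<close>

definition trans_run ::
  "('q \<times> ('a list \<times> 'b list) \<times> 'q) set \<Rightarrow> 'q \<Rightarrow> ('q \<times> ('a list \<times> 'b list) \<times> 'q) list \<Rightarrow> 'q list" where
  "trans_run D p ts = fold (\<lambda>t s. if t \<in> D \<and> s = [fst t] then [snd (snd t)] else []) ts [p]"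

definition inputs :: "('q \<times> ('a list \<times> 'b list) \<times> 'q) list \<Rightarrow> 'a list" where
  "inputs ts = concat (map (\<lambda>t. fst (fst (snd t))) ts)"

definition outputs :: "('q \<times> ('a list \<times> 'b list) \<times> 'q) list \<Rightarrow> 'b list" where
  "outputs ts = concat (map (\<lambda>t. snd (fst (snd t))) ts)"

lemma inputs_simps [simp]: "inputs [] = []" "inputs (t # ts) = fst (fst (snd t)) @ inputs ts"
    "inputs (ts @ ts') = inputs ts @ inputs ts'"
  and outputs_simps [simp]: "outputs [] = []" "outputs (t # ts) = snd (fst (snd t)) @ outputs ts"
    "outputs (ts @ ts') = outputs ts @ outputs ts'"
  by (simp_all add: inputs_def outputs_def)

lemma trans_run_Nil [simp]: "trans_run D p [] = [p]"
  by (simp add: trans_run_def)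

lemma fold_trans_empty:
  "fold (\<lambda>t s. if t \<in> D \<and> s = [f t] then [h t] else []) ts [] = []"
  by (induction ts) auto

lemma trans_run_Cons:
  "trans_run D p (t # ts) = (if t \<in> D \<and> p = fst t then trans_run D (snd (snd t)) ts else [])"
  by (auto simp: trans_run_def fold_trans_empty)

lemma trans_run_append:
  "trans_run D p (ts @ ts') = (case trans_run D p ts of [] \<Rightarrow> [] | q # _ \<Rightarrow> trans_run D q ts')"
  by (induction ts arbitrary: p) (auto simp: trans_run_Cons)

lemma trans_run_cases: "trans_run D p ts = [] \<or> (\<exists>q. trans_run D p ts = [q])"
  by (induction ts arbitrary: p) (auto simp: trans_run_Cons)

lemma trans_run_subset: "trans_run D p ts = [q] \<Longrightarrow> set ts \<subseteq> D"
  by (induction ts arbitrary: p) (auto simp: trans_run_Cons split: if_splits)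

lemma trans_run_prefix:
  assumes "trans_run D p (ts @ ts') = [q]"
  obtains r where "trans_run D p ts = [r]" "trans_run D r ts' = [q]"
  using assms trans_run_cases[of D p ts] by (auto simp: trans_run_append)

lemma path_iff_trans_run:
  "path T p u v q \<longleftrightarrow> (\<exists>ts. trans_run (transitions T) p ts = [q] \<and> inputs ts = u \<and> outputs ts = v)"
proof
  assume "path T p u v q"
  then show "\<exists>ts. trans_run (transitions T) p ts = [q] \<and> inputs ts = u \<and> outputs ts = v"
  proof induction
    case (path_Nil p)
    then show ?case by (intro exI[of _ "[]"]) simp
  next
    case (path_Cons p x y q u v r)
    then obtain ts where "trans_run (transitions T) q ts = [r]" "inputs ts = u" "outputs ts = v" by blast
    with path_Cons show ?case
      by (intro exI[of _ "(p, (x, y), q) # ts"]) (simp add: trans_run_Cons)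
  qed
next
  have "trans_run (transitions T) p ts = [q] \<Longrightarrow> path T p (inputs ts) (outputs ts) q" for ts
  proof (induction ts arbitrary: p)
    case Nil
    then show ?case by (auto intro: path_Nil)
  next
    case (Cons t ts)
    then have "t \<in> transitions T" "p = fst t" "path T (snd (snd t)) (inputs ts) (outputs ts) q"
      by (auto simp: trans_run_Cons split: if_splits)
    then show ?case using path_Cons by (cases t) fastforce
  qed
  then show "\<exists>ts. trans_run (transitions T) p ts = [q] \<and> inputs ts = u \<and> outputs ts = v \<Longrightarrow> path T p u v q"
    by blast
qed

lemma realized_iff:
  "(u, v) \<in> realized T \<longleftrightarrow> (\<exists>p \<in> initial T. \<exists>q \<in> final T. \<exists>ts.
     trans_run (transitions T) p ts = [q] \<and> inputs ts = u \<and> outputs ts = v)"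
  by (auto simp: realized_def path_iff_trans_run)

lemma length_concat_le: "(\<And>x. x \<in> set xs \<Longrightarrow> length x \<le> l) \<Longrightarrow> length (concat xs) \<le> length xs * l"
  by (induction xs) (auto simp: add_mono)

section \<open>Length-preserving transducers: short paths, bounded delay, finitely many
  residuals\<close>

locale length_preserving_transducer =
  fixes A :: "'a set" and T :: "('q, 'a, 'a) transducer" and l :: nat
  assumes fin_T: "finite_transducer A A T"
    and lp: "length_preserving (realized T)"
    and l: "\<And>p x y q. (p, (x, y), q) \<in> transitions T \<Longrightarrow> length x \<le> l \<and> length y \<le> l"
begin

abbreviation "D \<equiv> transitions T"
abbreviation "Q \<equiv> states T"

lemma finite_Q: "finite Q" and finite_alphabet: "finite A"
  using fin_T by (auto simp: finite_transducer_def)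

lemma trans_run_states: "trans_run D p ts = [q] \<Longrightarrow> p \<in> Q \<Longrightarrow> q \<in> Q"
proof (induction ts arbitrary: p)
  case (Cons t ts)
  then have "t \<in> D" "trans_run D (snd (snd t)) ts = [q]"
    by (auto simp: trans_run_Cons split: if_splits)
  moreover from this have "snd (snd t) \<in> Q" using fin_T by (auto simp: finite_transducer_def)
  ultimately show ?case using Cons.IH by blast
qed simp

text \<open>Labels may be empty on both sides, so a path can be longer than its words. A prefix of
  the path matters only through its end state and the amounts of u and v that it has read, which
  gives the three factors.\<close>

lemma short_path:
  assumes "trans_run D p ts = [q]" "p \<in> Q" "inputs ts = u" "outputs ts = v"
  shows "\<exists>ts. (trans_run D p ts = [q] \<and> inputs ts = u \<and> outputs ts = v) \<and>
    length ts < card Q * (Suc (length u) * Suc (length v))"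
proof -
  let ?good = "\<lambda>ts. trans_run D p ts = [q] \<and> inputs ts = u \<and> outputs ts = v"
  let ?g = "\<lambda>ts. (trans_run D p ts, inputs ts, outputs ts)"
  let ?X = "(\<lambda>q. [q]) ` Q \<times> (\<lambda>i. take i u) ` {..length u} \<times> (\<lambda>i. take i v) ` {..length v}"
  have "\<exists>ts. ?good ts \<and> length ts < card ?X"
  proof (rule short_good_list[where g = ?g])
    fix ts i assume good: "?good ts" and "i \<le> length ts"
    obtain r where r: "trans_run D p (take i ts) = [r]"
      using good trans_run_prefix[of D p "take i ts" "drop i ts"] by auto
    have "u = inputs (take i ts) @ inputs (drop i ts)" "v = outputs (take i ts) @ outputs (drop i ts)"
      using good by (metis append_take_drop_id inputs_simps(3), metis append_take_drop_id outputs_simps(3))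
    then have "inputs (take i ts) = take (length (inputs (take i ts))) u"
      "length (inputs (take i ts)) \<le> length u"
      "outputs (take i ts) = take (length (outputs (take i ts))) v"
      "length (outputs (take i ts)) \<le> length v"
      by simp_all
    then show "?g (take i ts) \<in> ?X"
      using trans_run_states[OF r \<open>p \<in> Q\<close>] r by (auto intro!: image_eqI)
  qed (use assms finite_Q in \<open>auto simp: trans_run_append split: list.splits\<close>)
  moreover have "card ?X \<le> card Q * (Suc (length u) * Suc (length v))"
    unfolding card_cartesian_product
    by (intro mult_le_mono order_trans[OF card_image_le]) (auto simp: finite_Q)
  ultimately show ?thesis using order.strict_trans2 by blast
qed

lemma short_coaccess:
  assumes "trans_run D p ts = [q]" "p \<in> Q"
  shows "\<exists>ts. trans_run D p ts = [q] \<and> length ts < card Q"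
proof -
  have "\<exists>ts. trans_run D p ts = [q] \<and> length ts < card ((\<lambda>q. [q]) ` Q)"
  proof (rule short_good_list[where g = "trans_run D p"])
    fix ts i assume good: "trans_run D p ts = [q]" and "i \<le> length ts"
    obtain r where r: "trans_run D p (take i ts) = [r]"
      using good trans_run_prefix[of D p "take i ts" "drop i ts"] by auto
    then show "trans_run D p (take i ts) \<in> (\<lambda>q. [q]) ` Q"
      using trans_run_states[OF r \<open>p \<in> Q\<close>] by auto
  qed (use assms finite_Q in \<open>auto simp: trans_run_append split: list.splits\<close>)
  then show ?thesis using card_image_le[OF finite_Q, of "\<lambda>q. [q]"] by (meson order.strict_trans2)
qed

lemma label_length: "trans_run D p ts = [q] \<Longrightarrow> length (inputs ts) \<le> length ts * l \<and> length (outputs ts) \<le> length ts * l"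
  using trans_run_subset[of D p ts q] l length_concat_le[of "map (\<lambda>t. fst (fst (snd t))) ts" l]
    length_concat_le[of "map (\<lambda>t. snd (fst (snd t))) ts" l]
  unfolding inputs_def outputs_def by fastforce

text \<open>A state on an accepting path reaches a final state by a short path, which has to make up
  for the difference of the lengths read so far.\<close>

lemma delay_bound:
  assumes "p \<in> initial T" "q \<in> final T" "trans_run D p ts = [r]" "trans_run D r ts' = [q]"
  shows "length (inputs ts) \<le> length (outputs ts) + card Q * l"
    "length (outputs ts) \<le> length (inputs ts) + card Q * l"
proof -
  have "p \<in> Q" using fin_T assms(1) by (auto simp: finite_transducer_def)
  then have "r \<in> Q" using trans_run_states assms(3) by blast
  then obtain ss where ss: "trans_run D r ss = [q]" "length ss < card Q"
    using short_coaccess assms(4) by blast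
  have "trans_run D p (ts @ ss) = [q]" using ss assms(3) by (simp add: trans_run_append)
  then have "(inputs (ts @ ss), outputs (ts @ ss)) \<in> realized T"
    using assms(1,2) realized_iff by metis
  from length_preservingD[OF lp this]
  have "length (inputs ts) + length (inputs ss) = length (outputs ts) + length (outputs ss)" by simp
  moreover have "length ss * l \<le> card Q * l" using ss(2) by simp
  ultimately show "length (inputs ts) \<le> length (outputs ts) + card Q * l"
    "length (outputs ts) \<le> length (inputs ts) + card Q * l"
    using label_length[OF ss(1)] by linarith+
qed

text \<open>A reachable state with the parts x and y of u and v still to be read. In the bound,
  \<open>card Q * l\<close> comes from \<open>delay_bound\<close>, and the extra \<open>l\<close> is
  for the label of a transition that reads beyond u or v.\<close>

definition configs :: "'a list \<Rightarrow> 'a list \<Rightarrow> ('q \<times> 'a list \<times> 'a list) set" where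
  "configs u v = {(r, x, y). length x \<le> card Q * l + l \<and> length y \<le> card Q * l + l \<and>
     (\<exists>p \<in> initial T. \<exists>ts. trans_run D p ts = [r] \<and> u = inputs ts @ x \<and> v = outputs ts @ y)}"

text \<open>An accepting run on \<open>(u @ w, v @ z)\<close> is split just before it reads beyond u
  or beyond v. One of the two rests is then no longer than a label, and the delay bound limits the
  other.\<close>

lemma residual_configs:
  assumes "length u = length v"
  shows "residual A (realized T) u v = {(w, z). w \<in> lists A \<and> z \<in> lists A \<and>
    (\<exists>(r, x, y) \<in> configs u v. \<exists>q \<in> final T. \<exists>ts. trans_run D r ts = [q] \<and>
      inputs ts = x @ w \<and> outputs ts = y @ z)}"
proof -
  have "(u @ w, v @ z) \<in> realized T \<longleftrightarrow> (\<exists>(r, x, y) \<in> configs u v. \<exists>q \<in> final T. \<exists>ts. trans_run D r ts = [q] \<and>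
      inputs ts = x @ w \<and> outputs ts = y @ z)" for w z
  proof
    assume "(u @ w, v @ z) \<in> realized T"
    then obtain p q ts where pq: "p \<in> initial T" "q \<in> final T" "trans_run D p ts = [q]"
      "inputs ts = u @ w" "outputs ts = v @ z" using realized_iff by metis
    define ok where "ok i \<longleftrightarrow> i \<le> length ts \<and> length (inputs (take i ts)) \<le> length u \<and>
      length (outputs (take i ts)) \<le> length v" for i
    define i where "i = (GREATEST i. ok i)"
    have "ok 0" by (simp add: ok_def)
    moreover have "\<And>j. ok j \<Longrightarrow> j \<le> length ts" by (simp add: ok_def)
    ultimately have i: "ok i" and max: "\<And>j. ok j \<Longrightarrow> j \<le> i"
      unfolding i_def by (metis GreatestI_nat, metis Greatest_le_nat)
    define t1 t2 where "t1 = take i ts" "t2 = drop i ts"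
    have ts: "ts = t1 @ t2" by (simp add: t1_t2_def)
    then obtain r where r: "trans_run D p t1 = [r]" "trans_run D r t2 = [q]"
      using trans_run_prefix pq(3) by metis
    have le: "length (inputs t1) \<le> length u" "length (outputs t1) \<le> length v"
      using i by (simp_all add: ok_def t1_t2_def)
    obtain x where x: "u = inputs t1 @ x" "inputs t2 = x @ w"
      using pq(4) ts le by (auto simp: append_eq_append_conv2)
    obtain y where y: "v = outputs t1 @ y" "outputs t2 = y @ z"
      using pq(5) ts le by (auto simp: append_eq_append_conv2)
    have db: "length x \<le> length y + card Q * l" "length y \<le> length x + card Q * l"
      using delay_bound[OF pq(1,2) r] assms x y by auto
    \<comment> \<open>By maximality of i the next transition reads beyond u or v; if there is no
      next transition, nothing is left to read.\<close>
    have "length x \<le> l \<or> length y \<le> l"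
    proof (cases t2)
      case Nil
      then show ?thesis using x by simp
    next
      case (Cons t t3)
      then have "\<not> ok (Suc i)" using max[of "Suc i"] by auto
      moreover have il: "i < length ts" using Cons t1_t2_def by (metis drop_eq_Nil list.distinct(1) not_less)
      moreover have "take (Suc i) ts = t1 @ [t]"
        using Cons il by (metis t1_t2_def drop_eq_Nil hd_drop_conv_nth list.sel(1) not_less take_Suc_conv_app_nth)
      moreover have "t \<in> D" using trans_run_subset[OF r(2)] Cons by simp
      ultimately show ?thesis
        using x y l[of "fst t" "fst (fst (snd t))" "snd (fst (snd t))" "snd (snd t)"]
        by (auto simp: ok_def)
    qed
    then have "(r, x, y) \<in> configs u v"
      unfolding configs_def using db pq(1) r(1) x(1) y(1) by auto
    then show "\<exists>(r, x, y) \<in> configs u v. \<exists>q \<in> final T. \<exists>ts. trans_run D r ts = [q] \<and>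
      inputs ts = x @ w \<and> outputs ts = y @ z" using pq(2) r(2) x(2) y(2) by blast
  next
    assume "\<exists>(r, x, y) \<in> configs u v. \<exists>q \<in> final T. \<exists>ts. trans_run D r ts = [q] \<and>
      inputs ts = x @ w \<and> outputs ts = y @ z"
    then obtain r x y q ts p ts' where *: "q \<in> final T" "trans_run D r ts = [q]"
      "inputs ts = x @ w" "outputs ts = y @ z" "p \<in> initial T" "trans_run D p ts' = [r]"
      "u = inputs ts' @ x" "v = outputs ts' @ y" by (auto simp: configs_def)
    then have "trans_run D p (ts' @ ts) = [q]" "inputs (ts' @ ts) = u @ w" "outputs (ts' @ ts) = v @ z"
      by (simp_all add: trans_run_append)
    then show "(u @ w, v @ z) \<in> realized T" using * realized_iff by metis
  qed
  then show ?thesis by (simp add: residual_def)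
qed

definition residuals :: "('a list \<times> 'a list) set set" where
  "residuals = (\<lambda>(u, v). residual A (realized T) u v) `
     {(u, v). u \<in> lists A \<and> v \<in> lists A \<and> length u = length v}"

definition short_words :: "'a list set" where
  "short_words = {x \<in> lists A. length x \<le> card Q * l + l}"

lemma finite_short_words: "finite short_words"
  using finite_lists_length_le[OF finite_alphabet, of "card Q * l + l"]
  by (simp add: short_words_def lists_eq_set)

text \<open>By \<open>residual_configs\<close> a residual is a function of a set of configurations;
  the exponent is the size of the finite set from which these are drawn.\<close>

lemma residuals_bound:
  "finite residuals" "card residuals \<le> 2 ^ (card Q * (card short_words * card short_words))"
proof -
  let ?X = "Pow (Q \<times> short_words \<times> short_words)"
  define F where "F C = {(w, z). w \<in> lists A \<and> z \<in> lists A \<and>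
    (\<exists>(r, x, y) \<in> C. \<exists>q \<in> final T. \<exists>ts. trans_run D r ts = [q] \<and>
      inputs ts = x @ w \<and> outputs ts = y @ z)}" for C
  have fin: "finite ?X" using finite_Q finite_short_words by simp
  have "configs u v \<in> ?X" if "u \<in> lists A" "v \<in> lists A" for u v
    using that fin_T trans_run_states
    by (auto simp: configs_def short_words_def finite_transducer_def)
  moreover have "residual A (realized T) u v = F (configs u v)" if "length u = length v" for u v
    unfolding F_def by (rule residual_configs[OF that])
  ultimately have "residual A (realized T) u v \<in> F ` ?X"
    if "u \<in> lists A" "v \<in> lists A" "length u = length v" for u v
    using that by (metis imageI)
  then have "residuals \<subseteq> F ` ?X"
    unfolding residuals_def by (intro image_subsetI) (simp add: case_prod_beta)
  then show "finite residuals" "card residuals \<le> 2 ^ (card Q * (card short_words * card short_words))"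
    using fin finite_surj[of ?X residuals F] surj_card_le[of ?X residuals F]
    by (simp_all add: card_Pow finite_Q finite_short_words card_cartesian_product)
qed

end

subsection \<open>A kernel is determined by its short words\<close>

lemma length_seq_run: "length (seq_run nx ot u) = Suc (length u)"
  by (induction u rule: rev_induct) auto

lemma seq_run_less:
  assumes "0 < n" "\<And>p a. nx p a < n"
  shows "hd0 (seq_run nx ot u) < n"
  by (cases u rule: rev_cases) (simp_all add: assms)

text \<open>A step inspects only the state at the head, so earlier outputs are carried along behind
  the new ones.\<close>

lemma fold_seq_run_append:
  fixes nx ot :: "nat \<Rightarrow> 'a \<Rightarrow> nat"
  defines "step \<equiv> \<lambda>a s. nx (hd0 s) a # ot (hd0 s) a # tl s"
  shows "fold step w (s # xs) = fold step w [s] @ xs \<and> length (fold step w [s]) = Suc (length w)"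
proof (induction w rule: rev_induct)
  case (snoc a w)
  have "hd0 (ys @ xs) = hd0 ys \<and> tl (ys @ xs) = tl ys @ xs" if "length ys = Suc m" for ys m
    using that by (cases ys) auto
  with snoc show ?case by (simp add: step_def)
qed simp

lemma seq_run_append:
  "seq_run nx ot (u @ w) =
     fold (\<lambda>a s. nx (hd0 s) a # ot (hd0 s) a # tl s) w [hd0 (seq_run nx ot u)] @ tl (seq_run nx ot u)"
proof -
  obtain s xs where run: "seq_run nx ot u = s # xs"
    using length_seq_run[of nx ot u] by (cases "seq_run nx ot u") auto
  have "seq_run nx ot (u @ w) = fold (\<lambda>a s. nx (hd0 s) a # ot (hd0 s) a # tl s) w (seq_run nx ot u)"
    by (simp add: seq_run_def)
  also have "\<dots> = fold (\<lambda>a s. nx (hd0 s) a # ot (hd0 s) a # tl s) w [s] @ xs"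
    unfolding run using fold_seq_run_append by blast
  finally show ?thesis by (simp add: run)
qed

text \<open>The new outputs on w and z are equally long, so complete outputs agree if and only if
  the old parts and the new parts agree; the new parts depend only on the states reached.\<close>

lemma seq_output_append_eq_iff:
  assumes "hd0 (seq_run nx ot u) = hd0 (seq_run nx ot u')"
    and "hd0 (seq_run nx ot v) = hd0 (seq_run nx ot v')"
    and "tl (seq_run nx ot u) = tl (seq_run nx ot v) \<longleftrightarrow> tl (seq_run nx ot u') = tl (seq_run nx ot v')"
    and "length w = length z"
  shows "seq_output nx ot ft (u @ w) = seq_output nx ot ft (v @ z) \<longleftrightarrow>
    seq_output nx ot ft (u' @ w) = seq_output nx ot ft (v' @ z)"
proof -
  define G where "G x s = fold (\<lambda>a s. nx (hd0 s) a # ot (hd0 s) a # tl s) x [s]" for x s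
  have len: "length (G x s) = Suc (length x)" for x s
    unfolding G_def using fold_seq_run_append[of nx ot x s "[]"] by simp
  have "seq_output nx ot ft (x @ y) =
      ft (hd0 (G y (hd0 (seq_run nx ot x)))) # tl (G y (hd0 (seq_run nx ot x))) @ tl (seq_run nx ot x)" for x y
    using len[of y "hd0 (seq_run nx ot x)"]
    by (cases "G y (hd0 (seq_run nx ot x))") (simp_all add: seq_output_def seq_run_append G_def[symmetric])
  then show ?thesis using assms len by simp
qed

lemma length_seq_output: "length (seq_output nx ot ft u) = Suc (length u)"
  by (simp add: seq_output_def length_seq_run)

context length_preserving_transducer
begin

text \<open>A shortest counterexample of equally long words, read as a list of pairs of letters, is
  cut by \<open>short_good_list\<close>. A prefix matters only through its residual, the two states
  reached and the agreement of the outputs so far: these are the factors of the bound. Words of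
  different lengths are related on neither side.\<close>

lemma kernel_eq_if_short:
  assumes n: "0 < n" "\<And>p a. nx p a < n"
    and short: "\<And>u v. u \<in> lists A \<Longrightarrow> v \<in> lists A \<Longrightarrow> length u = length v \<Longrightarrow>
      length u < card residuals * (n * (n * 2)) \<Longrightarrow>
      (u, v) \<in> realized T \<longleftrightarrow> seq_output nx ot ft u = seq_output nx ot ft v"
    and uv: "u \<in> lists A" "v \<in> lists A"
  shows "(u, v) \<in> realized T \<longleftrightarrow> seq_output nx ot ft u = seq_output nx ot ft v"
proof (cases "length u = length v")
  case False
  then have "(u, v) \<notin> realized T" using length_preservingD[OF lp] by blast
  moreover have "seq_output nx ot ft u \<noteq> seq_output nx ot ft v"
    using False length_seq_output by (metis nat.inject)
  ultimately show ?thesis by simp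
next
  case True
  let ?run = "seq_run nx ot" and ?out = "seq_output nx ot ft"
  define good where "good zs \<longleftrightarrow> zs \<in> lists (A \<times> A) \<and>
    \<not> ((map fst zs, map snd zs) \<in> realized T \<longleftrightarrow> ?out (map fst zs) = ?out (map snd zs))" for zs
  \<comment> \<open>The last component ensures that a prefix put in place of another is again over
    \<open>A\<close>; it is always true on prefixes of good lists, so it adds no factor to the size
    of the range.\<close>
  define g where "g zs = (residual A (realized T) (map fst zs) (map snd zs),
    hd0 (?run (map fst zs)), hd0 (?run (map snd zs)), tl (?run (map fst zs)) = tl (?run (map snd zs)),
    zs \<in> lists (A \<times> A))" for zs
  let ?X = "residuals \<times> {..<n} \<times> {..<n} \<times> (UNIV :: bool set) \<times> {True}"
  have proj: "map fst zs \<in> lists A" "map snd zs \<in> lists A" if "zs \<in> lists (A \<times> A)" for zs :: "('a \<times> 'a) list"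
    using that by (induction zs) auto
  have False if bad: "\<not> ?thesis"
  proof -
    have "\<exists>zs. good zs \<and> length zs < card ?X"
    proof (rule short_good_list[where g = g and good = good and X = ?X])
      show "finite ?X" using residuals_bound by simp
      show "g (take i zs) \<in> ?X" if "good zs" for zs i
      proof -
        have "take i zs \<in> lists (A \<times> A)" using that by (auto simp: good_def dest: in_set_takeD)
        then show ?thesis
          using proj[of "take i zs"] seq_run_less[where nx = nx, OF n]
          by (simp add: g_def residuals_def image_iff) (metis length_map)
      qed
      show "good (zs @ s)" if g: "g zs = g zs'" and good: "good (zs' @ s)" for zs zs' s
      proof -
        have s: "s \<in> lists (A \<times> A)" "zs' \<in> lists (A \<times> A)" "zs \<in> lists (A \<times> A)"
          using good g by (auto simp: good_def g_def)
        have "(map fst (zs @ s), map snd (zs @ s)) \<in> realized T \<longleftrightarrow>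
            (map fst s, map snd s) \<in> residual A (realized T) (map fst zs) (map snd zs)" for zs
          using proj[OF s(1)] by (simp add: residual_def)
        moreover have "?out (map fst (zs @ s)) = ?out (map snd (zs @ s)) \<longleftrightarrow>
            ?out (map fst (zs' @ s)) = ?out (map snd (zs' @ s))"
          unfolding map_append using g by (intro seq_output_append_eq_iff) (simp_all add: g_def)
        ultimately show ?thesis
          using good s g unfolding good_def g_def by auto
      qed
      show "good (zip u v)"
        using True bad uv unfolding good_def by (auto dest: set_zip_leftD set_zip_rightD)
    qed
    then obtain zs where zs: "good zs" "length zs < card ?X" by blast
    have "card ?X = card residuals * (n * (n * 2))"
      by (simp add: card_cartesian_product)
    then show False
      using zs short[of "map fst zs" "map snd zs"] proj[of zs] unfolding good_def by simp
  qed
  then show ?thesis by blast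
qed

end

section \<open>The search for a transducer\<close>

subsection \<open>Bounds on codes\<close>

text \<open>The code of the list of n copies of m, which is the largest code of a list of at most n
  entries not exceeding m.\<close>

definition code_bound :: "nat \<Rightarrow> nat \<Rightarrow> nat" where
  "code_bound m n = rec_nat 0 (\<lambda>_ y. Suc (prod_encode (m, y))) n"

lemma prod_encode_mono: "a \<le> a' \<Longrightarrow> b \<le> b' \<Longrightarrow> prod_encode (a, b) \<le> prod_encode (a', b')"
  unfolding prod_encode_def by (simp add: add_mono triangle_mono)

lemma list_encode_le_code_bound:
  "(\<And>x. x \<in> set xs \<Longrightarrow> x \<le> m) \<Longrightarrow> length xs \<le> n \<Longrightarrow> list_encode xs \<le> code_bound m n"
proof (induction n arbitrary: xs)
  case (Suc n)
  then show ?case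
    by (cases xs) (auto simp: code_bound_def intro!: prod_encode_mono)
qed simp

lemma pfst_le: "pfst z \<le> z" and psnd_le: "psnd z \<le> z"
  using le_prod_encode[of "pfst z" "psnd z"] by (simp_all add: pfst_def psnd_def)

lemma nth0_le: "nth0 xs i \<le> list_encode xs"
  using mem_less_list_encode[of "xs ! i" xs] by (auto simp: nth0_eq)

subsection \<open>Machines coded by numbers\<close>

text \<open>Every number codes a machine: out-of-range values of the transition table are reduced
  modulo the number of states.\<close>

definition m_size :: "nat \<Rightarrow> nat" where
  "m_size e = Suc (pfst e)"

definition m_entry :: "nat \<Rightarrow> nat \<Rightarrow> nat \<Rightarrow> nat" where
  "m_entry e p i = nth0 (list_decode (pfst (psnd e))) (prod_encode (p, i))"

definition m_next :: "nat \<Rightarrow> nat \<Rightarrow> nat \<Rightarrow> nat" where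
  "m_next e p i = pfst (m_entry e p i) mod m_size e"

definition m_out :: "nat \<Rightarrow> nat \<Rightarrow> nat \<Rightarrow> nat" where
  "m_out e p i = psnd (m_entry e p i)"

definition m_final :: "nat \<Rightarrow> nat \<Rightarrow> nat" where
  "m_final e p = nth0 (list_decode (psnd (psnd e))) p"

definition m_output :: "nat \<Rightarrow> nat list \<Rightarrow> nat list" where
  "m_output e = seq_output (m_next e) (m_out e) (m_final e)"

lemma m_next_less: "m_next e p i < m_size e"
  by (simp add: m_next_def m_size_def)

text \<open>Together with \<open>m_final_le\<close>, this lets \<open>{0..<Suc e}\<close> serve as
  the output alphabet of the machine e.\<close>

lemma m_out_le: "m_out e p i \<le> e"
proof -
  have "m_out e p i \<le> m_entry e p i" by (simp add: m_out_def psnd_le)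
  also have "\<dots> \<le> pfst (psnd e)" unfolding m_entry_def using nth0_le by (metis list_decode_inverse)
  also have "\<dots> \<le> e" using pfst_le psnd_le order_trans by blast
  finally show ?thesis .
qed

lemma m_final_le: "m_final e p \<le> e"
proof -
  have "m_final e p \<le> psnd (psnd e)" unfolding m_final_def using nth0_le by (metis list_decode_inverse)
  also have "\<dots> \<le> e" using psnd_le order_trans by blast
  finally show ?thesis .
qed

lemma cn_m_size [comp_intros]: "cn F \<Longrightarrow> cn (\<lambda>z. m_size (F z))"
  unfolding m_size_def by (intro comp_intros)

lemma cn_m_next [comp_intros]: "cn F \<Longrightarrow> cn G \<Longrightarrow> cn H \<Longrightarrow> cn (\<lambda>z. m_next (F z) (G z) (H z))"
  unfolding m_next_def m_entry_def by (intro comp_intros)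

lemma cn_m_out [comp_intros]: "cn F \<Longrightarrow> cn G \<Longrightarrow> cn H \<Longrightarrow> cn (\<lambda>z. m_out (F z) (G z) (H z))"
  unfolding m_out_def m_entry_def by (intro comp_intros)

lemma cn_m_final [comp_intros]: "cn F \<Longrightarrow> cn G \<Longrightarrow> cn (\<lambda>z. m_final (F z) (G z))"
  unfolding m_final_def by (intro comp_intros)

lemma cl_m_output [comp_intros]:
  assumes "cn F" "cl G"
  shows "cl (\<lambda>z. m_output (F z) (G z))"
  unfolding m_output_def seq_output_def seq_run_def
  by (intro comp_intros assms cn_compose[OF assms(1)])

lemma seq_run_map: "seq_run nx ot (map \<alpha> u) = seq_run (\<lambda>p a. nx p (\<alpha> a)) (\<lambda>p a. ot p (\<alpha> a)) u"
  by (simp add: seq_run_def fold_map comp_def)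

lemma m_output_map:
  "m_output e (map \<alpha> u) = seq_output (\<lambda>p a. m_next e p (\<alpha> a)) (\<lambda>p a. m_out e p (\<alpha> a)) (m_final e) u"
  by (simp add: m_output_def seq_output_def seq_run_map)

lemma ex_machine_code:
  fixes \<alpha> :: "'a \<Rightarrow> nat"
  assumes A: "finite A" "inj_on \<alpha> A" and n: "0 < n" "\<And>p a. nx p a < n"
  shows "\<exists>e. \<forall>u \<in> lists A. m_output e (map \<alpha> u) = seq_output nx ot ft u"
proof -
  have "finite ((\<lambda>(p, a). prod_encode (p, \<alpha> a)) ` ({..<n} \<times> A))" using A(1) by simp
  then obtain M where "\<forall>z \<in> (\<lambda>(p, a). prod_encode (p, \<alpha> a)) ` ({..<n} \<times> A). z < M"
    unfolding finite_nat_set_iff_bounded by blast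
  then have M: "prod_encode (p, \<alpha> a) < M" if "p < n" "a \<in> A" for p a
    using that by auto
  \<comment> \<open>The table reaches beyond the code of every pair of a state and a letter of
    \<open>A\<close>; its other entries are arbitrary.\<close>
  define tbl where "tbl = map (\<lambda>z. prod_encode (nx (pfst z) (inv_into A \<alpha> (psnd z)),
    ot (pfst z) (inv_into A \<alpha> (psnd z)))) [0..<M]"
  \<comment> \<open>The first component is \<open>n - 1\<close> because \<open>m_size\<close> adds
    1.\<close>
  define e where "e = prod_encode (n - 1, prod_encode (list_encode tbl, list_encode (map ft [0..<n])))"
  have size: "m_size e = n" using n(1) by (simp add: m_size_def e_def)
  have entry: "m_next e p (\<alpha> a) = nx p a \<and> m_out e p (\<alpha> a) = ot p a" if "p < n" "a \<in> A" for p a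
    using M[OF that] that A(2) n(2)[of p a] size
    by (simp add: m_next_def m_out_def m_entry_def e_def tbl_def nth0_eq)
  have final: "m_final e p = ft p" if "p < n" for p
    using that by (simp add: m_final_def e_def nth0_eq)
  have less: "hd0 (seq_run nx ot u) < n" for u using seq_run_less[where nx = nx, OF n] .
  have "seq_run (\<lambda>p a. m_next e p (\<alpha> a)) (\<lambda>p a. m_out e p (\<alpha> a)) u = seq_run nx ot u"
    if "u \<in> lists A" for u
    using that
  proof (induction u rule: rev_induct)
    case (snoc a u)
    then show ?case using entry[OF less[of u], of a] by simp
  qed simp
  then have "m_output e (map \<alpha> u) = seq_output nx ot ft u" if "u \<in> lists A" for u
    using that final[OF less[of u]] by (simp add: m_output_map seq_output_def)
  then show ?thesis by blast
qed

subsection \<open>The test\<close>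

text \<open>The positions follow \<open>transducer_code\<close>: 0 is the input alphabet, 3 the
  transitions, 4 the initial and 5 the final states.\<close>

definition component :: "nat \<Rightarrow> nat \<Rightarrow> nat list" where
  "component c i = list_decode (nth0 (list_decode c) i)"

text \<open>This is \<open>trans_run\<close> on codes; entries 0 to 3 of a transition code are
  source, input, output and target.\<close>

definition accepts :: "nat \<Rightarrow> nat list \<Rightarrow> nat list \<Rightarrow> nat list \<Rightarrow> bool" where
  "accepts c ts u v \<longleftrightarrow>
     (\<exists>p \<in> set (component c 4). \<exists>q \<in> set (component c 5).
        fold (\<lambda>t s. if t \<in> set (component c 3) \<and> s = [nth0 (list_decode t) 0]
          then [nth0 (list_decode t) 3] else []) ts [p] = [q]) \<and>
     concat (map (\<lambda>t. list_decode (nth0 (list_decode t) 1)) ts) = u \<and>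
     concat (map (\<lambda>t. list_decode (nth0 (list_decode t) 2)) ts) = v"

text \<open>The inner \<open>code_bound\<close> limits the codes of the words in
  \<open>short_words\<close>, with c for both the number of states and the label length; so the
  power limits \<open>card residuals\<close>. Multiplied by the remaining factors it is the length
  bound of \<open>kernel_eq_if_short\<close>, and the outer \<open>code_bound\<close> passes from
  lengths to codes, no letter being coded by a number above c.\<close>

definition word_code_bound :: "nat \<Rightarrow> nat \<Rightarrow> nat" where
  "word_code_bound c e = code_bound c
     (2 ^ (c * (Suc (code_bound c (c * c + c)) * Suc (code_bound c (c * c + c)))) *
       (m_size e * (m_size e * 2)))"

text \<open>The length bound of \<open>short_path\<close> with c for the number of states, turned
  into a bound on codes of lists of transitions.\<close>

definition path_code_bound :: "nat \<Rightarrow> nat \<Rightarrow> nat" where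
  "path_code_bound c w = code_bound c (c * (Suc w * Suc w))"

definition kernel_test :: "nat \<Rightarrow> nat \<Rightarrow> bool" where
  "kernel_test c e \<longleftrightarrow> (\<forall>i < Suc (word_code_bound c e). \<forall>j < Suc (word_code_bound c e).
     (\<forall>a \<in> set (list_decode i). a \<in> set (component c 0)) \<and>
     (\<forall>a \<in> set (list_decode j). a \<in> set (component c 0)) \<longrightarrow>
     ((\<exists>z < Suc (path_code_bound c (word_code_bound c e)).
         accepts c (list_decode z) (list_decode i) (list_decode j)) \<longleftrightarrow>
       m_output e (list_decode i) = m_output e (list_decode j)))"

definition result_code :: "nat \<Rightarrow> nat \<Rightarrow> nat" where
  "result_code c e = prod_encode (list_encode
     [nth0 (list_decode c) 0,
      list_encode [0..<Suc e],
      list_encode [0..<m_size e],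
      list_encode (concat (map (\<lambda>p. map (\<lambda>a. list_encode
        [p, list_encode [a], list_encode [m_out e p a], m_next e p a]) (component c 0)) [0..<m_size e])),
      list_encode [0],
      list_encode [0..<m_size e]],
     list_encode (map (\<lambda>p. prod_encode (p, m_final e p)) [0..<m_size e]))"

lemma cn_code_bound [comp_intros]:
  assumes "cn F" "cn G"
  shows "cn (\<lambda>z. code_bound (F z) (G z))"
  unfolding code_bound_def by (intro comp_intros assms cn_compose[OF assms(1)])

lemma cl_component [comp_intros]: "cn F \<Longrightarrow> cl (\<lambda>z. component (F z) i)"
  unfolding component_def by (intro comp_intros)

lemma cb_accepts [comp_intros]:
  assumes "cn F" "cl G" "cl H" "cl I"
  shows "cb (\<lambda>z. accepts (F z) (G z) (H z) (I z))"
  unfolding accepts_def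
  by (intro comp_intros assms cn_compose[OF assms(1)] cl_compose[OF assms(2)])

lemma cb_kernel_test: "cb (\<lambda>z. kernel_test (psnd z) (pfst z))"
  unfolding kernel_test_def word_code_bound_def path_code_bound_def by (intro comp_intros)

lemma cn_result_code: "cn (\<lambda>z. result_code (pfst z) (psnd z))"
  unfolding result_code_def by (intro comp_intros)

lemma fold_trans_subset:
  "fold (\<lambda>t s. if t \<in> D \<and> s = [f t] then [h t] else []) ts s = [q] \<Longrightarrow> set ts \<subseteq> D"
  by (induction ts arbitrary: s) (auto simp: fold_trans_empty split: if_splits)

section \<open>Correctness of the test for a given coded transducer\<close>

locale coded_transducer =
  fixes A :: "'a set" and T :: "('q, 'a, 'a) transducer" and \<kappa> :: "'q \<Rightarrow> nat" and \<alpha> :: "'a \<Rightarrow> nat"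
    and c :: nat
  assumes fin_T: "finite_transducer A A T"
    and lp: "length_preserving (realized T)"
    and code: "transducer_code \<kappa> \<alpha> \<alpha> A A T c"
begin

abbreviation "tc \<equiv> transition_code \<kappa> \<alpha> \<alpha>"

text \<open>The entries of a list are smaller than its code and its length is at most its code, so c
  dominates the letters, the transition codes, the number of states and the label lengths. Hence c
  can stand for all these parameters in the bounds of the test.\<close>

lemma code_lists:
  obtains as qs ds "is" fs where
    "set as = A" "component c 0 = map \<alpha> as" "nth0 (list_decode c) 0 = list_encode (map \<alpha> as)"
    "set qs = states T" "list_encode (map \<kappa> qs) \<le> c"
    "set ds = transitions T" "component c 3 = map tc ds"
    "set is = initial T" "component c 4 = map \<kappa> is"
    "set fs = final T" "component c 5 = map \<kappa> fs"
    "\<And>i x. i \<in> {0, 3} \<Longrightarrow> x \<in> set (component c i) \<Longrightarrow> x \<le> c"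
proof -
  obtain as bs qs ds "is" fs where *:
    "set as = A" "set qs = states T" "set ds = transitions T" "set is = initial T" "set fs = final T"
    "c = list_encode [list_encode (map \<alpha> as), list_encode (map \<alpha> bs), list_encode (map \<kappa> qs),
      list_encode (map tc ds), list_encode (map \<kappa> is), list_encode (map \<kappa> fs)]"
    using code unfolding transducer_code_def lists_set_def by blast
  have comp: "component c 0 = map \<alpha> as" "nth0 (list_decode c) 0 = list_encode (map \<alpha> as)"
    "component c 3 = map tc ds" "component c 4 = map \<kappa> is" "component c 5 = map \<kappa> fs"
    unfolding *(6) component_def list_encode_inverse by (simp_all add: nth0_eq)
  have le: "x \<in> {list_encode (map \<alpha> as), list_encode (map \<kappa> qs), list_encode (map tc ds)} \<Longrightarrow> x \<le> c" for x
    unfolding *(6) by (intro less_imp_le mem_less_list_encode) auto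
  have "x \<le> c" if "i \<in> {0, 3}" "x \<in> set (component c i)" for i x
  proof -
    have "x < list_encode (component c i)" using that by (intro mem_less_list_encode)
    moreover have "list_encode (component c i) \<le> c"
      using that(1) by (auto simp only: insert_iff comp intro!: le)
    ultimately show ?thesis by simp
  qed
  then show ?thesis using that[OF *(1) comp(1,2) *(2) le *(3) comp(3) *(4) comp(4) *(5) comp(5)] by simp
qed

lemma inj_\<alpha>: "inj_on \<alpha> A" and inj_\<kappa>: "inj_on \<kappa> (states T)"
  using code by (auto simp: transducer_code_def)

lemma map_\<alpha>_eq_iff: "u \<in> lists A \<Longrightarrow> v \<in> lists A \<Longrightarrow> map \<alpha> u = map \<alpha> v \<longleftrightarrow> u = v"
  by (intro inj_on_map_eq_map inj_on_subset[OF inj_\<alpha>]) auto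

lemma set_component_0: "set (component c 0) = \<alpha> ` A"
  by (rule code_lists) simp

lemma set_component_3: "set (component c 3) = tc ` transitions T"
  by (rule code_lists) simp

lemma set_component_4: "set (component c 4) = \<kappa> ` initial T"
  by (rule code_lists) simp

lemma set_component_5: "set (component c 5) = \<kappa> ` final T"
  by (rule code_lists) simp

lemma \<alpha>_le: "a \<in> A \<Longrightarrow> \<alpha> a \<le> c"
  using code_lists set_component_0 by (metis imageI insertI1)

lemma tc_le: "t \<in> transitions T \<Longrightarrow> tc t \<le> c"
  using code_lists set_component_3 by (metis imageI insertCI)

lemma card_states_le: "card (states T) \<le> c"
proof -
  obtain qs where "set qs = states T" "list_encode (map \<kappa> qs) \<le> c" by (rule code_lists)
  then show ?thesis
    using card_length[of qs] length_le_list_encode[of "map \<kappa> qs"] by simp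
qed

lemma label_le:
  assumes "(p, (x, y), q) \<in> transitions T"
  shows "length x \<le> c \<and> length y \<le> c"
proof -
  have "list_encode (map \<alpha> x) < tc (p, (x, y), q)" "list_encode (map \<alpha> y) < tc (p, (x, y), q)"
    unfolding transition_code_def prod.case by (rule mem_less_list_encode; simp)+
  then show ?thesis
    using tc_le[OF assms] length_le_list_encode[of "map \<alpha> x"] length_le_list_encode[of "map \<alpha> y"] by simp
qed

sublocale length_preserving_transducer A T c
  using fin_T lp label_le by unfold_locales auto

lemma list_decode_tc:
  "list_decode (tc t) = [\<kappa> (fst t), list_encode (map \<alpha> (fst (fst (snd t)))),
     list_encode (map \<alpha> (snd (fst (snd t)))), \<kappa> (snd (snd t))]"
  by (cases t) (auto simp: transition_code_def simp del: list_encode.simps)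

text \<open>The simulation on codes is faithful because \<kappa> is injective on states; this is why
  the current state is kept inside \<open>Q\<close>.\<close>

lemma fold_tc:
  assumes "set ts \<subseteq> D" "set s \<subseteq> Q"
  shows "fold (\<lambda>t s. if t \<in> set (component c 3) \<and> s = [nth0 (list_decode t) 0]
      then [nth0 (list_decode t) 3] else []) (map tc ts) (map \<kappa> s)
    = map \<kappa> (fold (\<lambda>t s. if t \<in> D \<and> s = [fst t] then [snd (snd t)] else []) ts s)"
  using assms
proof (induction ts arbitrary: s)
  case (Cons t ts)
  have t: "t \<in> D" "fst t \<in> Q" "snd (snd t) \<in> Q"
    using Cons.prems fin_T by (auto simp: finite_transducer_def)
  have "map \<kappa> s = [\<kappa> (fst t)] \<longleftrightarrow> s = [fst t]"
    using inj_onD[OF inj_\<kappa>] t Cons.prems by (cases s) auto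
  then show ?case
    using Cons.IH[of "if s = [fst t] then [snd (snd t)] else []"] t Cons.prems
    by (simp add: list_decode_tc nth0_eq set_component_3 if_distrib cong: if_cong)
qed simp

lemma labels_lists: "set ts \<subseteq> D \<Longrightarrow> inputs ts \<in> lists A \<and> outputs ts \<in> lists A"
  using fin_T unfolding inputs_def outputs_def finite_transducer_def
  by (induction ts) auto

lemma concat_tc:
  "concat (map (\<lambda>t. list_decode (nth0 (list_decode t) 1)) (map tc ts)) = map \<alpha> (inputs ts)"
  "concat (map (\<lambda>t. list_decode (nth0 (list_decode t) 2)) (map tc ts)) = map \<alpha> (outputs ts)"
  by (induction ts) (simp_all add: list_decode_tc nth0_eq)

lemma accepts_map_tc:
  assumes ts: "set ts \<subseteq> D" and uv: "u \<in> lists A" "v \<in> lists A"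
  shows "accepts c (map tc ts) (map \<alpha> u) (map \<alpha> v) \<longleftrightarrow>
    (\<exists>p \<in> initial T. \<exists>q \<in> final T. trans_run D p ts = [q] \<and> inputs ts = u \<and> outputs ts = v)"
proof -
  have "map \<alpha> (inputs ts) = map \<alpha> u \<longleftrightarrow> inputs ts = u"
    using labels_lists[OF ts] uv map_\<alpha>_eq_iff by blast
  moreover have "map \<alpha> (outputs ts) = map \<alpha> v \<longleftrightarrow> outputs ts = v"
    using labels_lists[OF ts] uv map_\<alpha>_eq_iff by blast
  moreover have "fold (\<lambda>t s. if t \<in> set (component c 3) \<and> s = [nth0 (list_decode t) 0]
      then [nth0 (list_decode t) 3] else []) (map tc ts) [\<kappa> p] = [\<kappa> q] \<longleftrightarrow> trans_run D p ts = [q]"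
    if "p \<in> initial T" "q \<in> final T" for p q
  proof -
    have pq: "p \<in> Q" "q \<in> Q" using that fin_T by (auto simp: finite_transducer_def)
    have "map \<kappa> (trans_run D p ts) = [\<kappa> q] \<longleftrightarrow> trans_run D p ts = [q]"
      using trans_run_cases[of D p ts] trans_run_states[of p ts] pq inj_onD[OF inj_\<kappa>] by auto
    then show ?thesis using fold_tc[OF ts, of "[p]"] pq by (simp add: trans_run_def)
  qed
  ultimately show ?thesis
    unfolding accepts_def concat_tc set_component_4 set_component_5 by auto
qed

text \<open>\<open>short_path\<close> makes the search for a path bounded. Conversely, a list of
  arbitrary numbers is accepted only if all its entries are codes of transitions.\<close>

lemma realized_iff_accepts:
  assumes uv: "u \<in> lists A" "v \<in> lists A" and w: "length u \<le> w" "length v \<le> w"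
  shows "(u, v) \<in> realized T \<longleftrightarrow>
    (\<exists>z < Suc (path_code_bound c w). accepts c (list_decode z) (map \<alpha> u) (map \<alpha> v))"
proof
  assume "(u, v) \<in> realized T"
  then obtain p q ts0 where pq: "p \<in> initial T" "q \<in> final T"
    and ts0: "trans_run D p ts0 = [q]" "inputs ts0 = u" "outputs ts0 = v" unfolding realized_iff by blast
  have "p \<in> Q" using pq(1) fin_T by (auto simp: finite_transducer_def)
  from short_path[OF ts0(1) this ts0(2,3)]
  obtain ts where ts: "trans_run D p ts = [q]" "inputs ts = u" "outputs ts = v"
    "length ts < card Q * (Suc (length u) * Suc (length v))" by blast
  have sub: "set ts \<subseteq> D" by (rule trans_run_subset[OF ts(1)])
  have "card Q * (Suc (length u) * Suc (length v)) \<le> c * (Suc w * Suc w)"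
    by (intro mult_le_mono card_states_le Suc_le_mono[THEN iffD2] w)
  then have "list_encode (map tc ts) \<le> path_code_bound c w"
    unfolding path_code_bound_def using ts(4) sub tc_le by (intro list_encode_le_code_bound) auto
  moreover have "accepts c (list_decode (list_encode (map tc ts))) (map \<alpha> u) (map \<alpha> v)"
    using accepts_map_tc[OF sub uv] pq ts by auto
  ultimately show "\<exists>z < Suc (path_code_bound c w). accepts c (list_decode z) (map \<alpha> u) (map \<alpha> v)"
    by (meson le_imp_less_Suc)
next
  assume "\<exists>z < Suc (path_code_bound c w). accepts c (list_decode z) (map \<alpha> u) (map \<alpha> v)"
  then obtain ts' where acc: "accepts c ts' (map \<alpha> u) (map \<alpha> v)" by blast
  then obtain p q where "fold (\<lambda>t s. if t \<in> set (component c 3) \<and> s = [nth0 (list_decode t) 0]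
      then [nth0 (list_decode t) 3] else []) ts' [p] = [q]"
    unfolding accepts_def by blast
  then have "set ts' \<subseteq> tc ` D"
    unfolding set_component_3 by (rule fold_trans_subset)
  then have "ts' \<in> lists (tc ` D)" by auto
  then obtain ts where ts: "ts' = map tc ts" "set ts \<subseteq> D" unfolding lists_image by auto
  then show "(u, v) \<in> realized T"
    using acc accepts_map_tc[OF ts(2) uv] realized_iff by metis
qed

lemma kernel_test_iff:
  "kernel_test c e \<longleftrightarrow> (\<forall>u \<in> lists A. \<forall>v \<in> lists A.
     list_encode (map \<alpha> u) \<le> word_code_bound c e \<longrightarrow> list_encode (map \<alpha> v) \<le> word_code_bound c e \<longrightarrow>
     ((u, v) \<in> realized T \<longleftrightarrow> m_output e (map \<alpha> u) = m_output e (map \<alpha> v)))"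
  (is "_ \<longleftrightarrow> ?rhs")
proof -
  let ?W = "word_code_bound c e"
  have word: "(\<forall>a \<in> set (list_decode i). a \<in> set (component c 0)) \<longleftrightarrow>
      (\<exists>u \<in> lists A. i = list_encode (map \<alpha> u))" for i
  proof -
    have "(\<forall>a \<in> set (list_decode i). a \<in> set (component c 0)) \<longleftrightarrow> list_decode i \<in> map \<alpha> ` lists A"
      unfolding set_component_0 lists_image[symmetric] by (simp add: in_lists_conv_set)
    then show ?thesis by (metis image_iff list_decode_inverse list_encode_inverse)
  qed
  have len: "length u \<le> ?W" if "list_encode (map \<alpha> u) \<le> ?W" for u
    using that length_le_list_encode[of "map \<alpha> u"] by simp
  have "kernel_test c e \<longleftrightarrow> (\<forall>u \<in> lists A. \<forall>v \<in> lists A.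
     list_encode (map \<alpha> u) \<le> ?W \<longrightarrow> list_encode (map \<alpha> v) \<le> ?W \<longrightarrow>
     ((\<exists>z < Suc (path_code_bound c ?W). accepts c (list_decode z) (map \<alpha> u) (map \<alpha> v)) \<longleftrightarrow>
       m_output e (map \<alpha> u) = m_output e (map \<alpha> v)))"
    (is "_ \<longleftrightarrow> ?mid")
  proof
    assume "kernel_test c e"
    then show ?mid
      unfolding kernel_test_def word less_Suc_eq_le using list_encode_inverse by metis
  next
    assume mid: ?mid
    show "kernel_test c e"
      unfolding kernel_test_def word less_Suc_eq_le
    proof (intro allI impI, elim conjE bexE)
      fix i j u v assume "i \<le> ?W" "j \<le> ?W" "u \<in> lists A" "i = list_encode (map \<alpha> u)"
        "v \<in> lists A" "j = list_encode (map \<alpha> v)"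
      then show "(\<exists>z \<le> path_code_bound c ?W. accepts c (list_decode z) (list_decode i) (list_decode j)) \<longleftrightarrow>
          m_output e (list_decode i) = m_output e (list_decode j)"
        using mid[rule_format, of u v] by (simp only: list_encode_inverse less_Suc_eq_le)
    qed
  qed
  also have "\<dots> \<longleftrightarrow> ?rhs"
    using realized_iff_accepts[OF _ _ len len] by (intro ball_cong imp_cong refl) metis
  finally show ?thesis .
qed

text \<open>Short words are counted through their codes, which are distinct as \<alpha> is injective
  on \<open>A\<close>.\<close>

lemma residual_count_le:
  "card residuals \<le> 2 ^ (c * (Suc (code_bound c (c * c + c)) * Suc (code_bound c (c * c + c))))"
proof -
  have "card short_words \<le> card {..code_bound c (c * c + c)}"
  proof (rule card_inj_on_le)
    show "inj_on (\<lambda>u. list_encode (map \<alpha> u)) short_words"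
    proof (rule inj_onI)
      fix x y assume *: "x \<in> short_words" "y \<in> short_words" "list_encode (map \<alpha> x) = list_encode (map \<alpha> y)"
      then show "x = y"
        using map_\<alpha>_eq_iff[of x y] by (simp add: short_words_def list_encode_eq)
    qed
    have "length x \<le> c * c + c" if "x \<in> short_words" for x
    proof -
      have "card Q * c \<le> c * c" by (rule mult_le_mono1[OF card_states_le])
      moreover have "length x \<le> card Q * c + c" using that by (simp add: short_words_def)
      ultimately show ?thesis by linarith
    qed
    then show "(\<lambda>u. list_encode (map \<alpha> u)) ` short_words \<subseteq> {..code_bound c (c * c + c)}"
      using \<alpha>_le by (force simp: short_words_def intro!: list_encode_le_code_bound)
  qed simp
  then have "card short_words \<le> Suc (code_bound c (c * c + c))" by simp
  then have "card Q * (card short_words * card short_words) \<le>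
      c * (Suc (code_bound c (c * c + c)) * Suc (code_bound c (c * c + c)))"
    by (intro mult_le_mono card_states_le)
  then show ?thesis using residuals_bound(2) by (meson one_le_numeral order_trans power_increasing)
qed

lemma kernel_test_correct:
  assumes "kernel_test c e" "u \<in> lists A" "v \<in> lists A"
  shows "(u, v) \<in> realized T \<longleftrightarrow> m_output e (map \<alpha> u) = m_output e (map \<alpha> v)"
  unfolding m_output_map
proof (rule kernel_eq_if_short[OF _ _ _ assms(2,3)])
  fix u v assume uv: "u \<in> lists A" "v \<in> lists A" "length u = length v"
    "length u < card residuals * (m_size e * (m_size e * 2))"
  have "card residuals * (m_size e * (m_size e * 2)) \<le>
      2 ^ (c * (Suc (code_bound c (c * c + c)) * Suc (code_bound c (c * c + c)))) * (m_size e * (m_size e * 2))"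
    using residual_count_le by (intro mult_le_mono) auto
  with uv(4) have "length u \<le> 2 ^ (c * (Suc (code_bound c (c * c + c)) * Suc (code_bound c (c * c + c)))) *
      (m_size e * (m_size e * 2))" by (meson less_imp_le order_trans)
  then have "list_encode (map \<alpha> u) \<le> word_code_bound c e" "list_encode (map \<alpha> v) \<le> word_code_bound c e"
    unfolding word_code_bound_def using uv(1-3) \<alpha>_le
    by (auto intro!: list_encode_le_code_bound simp del: mult_Suc mult_Suc_right)
  then show "(u, v) \<in> realized T \<longleftrightarrow>
      seq_output (\<lambda>p a. m_next e p (\<alpha> a)) (\<lambda>p a. m_out e p (\<alpha> a)) (m_final e) u =
      seq_output (\<lambda>p a. m_next e p (\<alpha> a)) (\<lambda>p a. m_out e p (\<alpha> a)) (m_final e) v"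
    using assms(1)[unfolded kernel_test_iff m_output_map, rule_format, OF uv(1,2)] by blast
qed (use m_next_less in \<open>auto simp: m_size_def\<close>)

subsection \<open>The transducer of a machine code\<close>

text \<open>All states are final, so that the realized function is total.\<close>

definition m_transducer :: "nat \<Rightarrow> (nat, 'a, nat) transducer" where
  "m_transducer e = \<lparr>states = {0..<m_size e},
     transitions = (\<lambda>(p, a). (p, ([a], [m_out e p (\<alpha> a)]), m_next e p (\<alpha> a))) ` ({0..<m_size e} \<times> A),
     initial = {0}, final = {0..<m_size e}\<rparr>"

lemma finite_m_transducer: "finite_transducer A {0..<Suc e} (m_transducer e)"
  using finite_alphabet m_next_less m_out_le
  by (auto simp: finite_transducer_def m_transducer_def m_size_def le_imp_less_Suc)

lemma subsequential_m_transducer: "subsequential_transducer A {0..<Suc e} (m_transducer e) (m_final e)"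
  unfolding subsequential_transducer_def sequential_def
  using finite_m_transducer m_final_le
  by (auto simp: m_transducer_def le_imp_less_Suc)

lemma letter_to_letter_m_transducer: "letter_to_letter (m_transducer e)"
  by (auto simp: letter_to_letter_def m_transducer_def)

lemma m_transducer_path:
  assumes "path (m_transducer e) p u v q"
  shows "u \<in> lists A \<and> fold (\<lambda>a s. m_next e (hd0 s) (\<alpha> a) # m_out e (hd0 s) (\<alpha> a) # tl s) u (p # xs)
    = q # rev v @ xs"
  using assms
proof (induction arbitrary: xs)
  case (path_Cons p x y q u v r)
  from path_Cons.hyps(1) obtain a where "a \<in> A" "x = [a]" "y = [m_out e p (\<alpha> a)]" "q = m_next e p (\<alpha> a)"
    by (auto simp: m_transducer_def)
  then show ?case using path_Cons.IH[of "m_out e p (\<alpha> a) # xs"] by simp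
qed simp

lemma m_transducer_total:
  "u \<in> lists A \<Longrightarrow> p < m_size e \<Longrightarrow> \<exists>v q. q < m_size e \<and> path (m_transducer e) p u v q"
proof (induction u arbitrary: p)
  case Nil
  then show ?case using path_Nil by metis
next
  case (Cons a u)
  then have "u \<in> lists A" "a \<in> A" by auto
  then obtain v q where "q < m_size e" "path (m_transducer e) (m_next e p (\<alpha> a)) u v q"
    using Cons.IH m_next_less by blast
  moreover have "(p, ([a], [m_out e p (\<alpha> a)]), m_next e p (\<alpha> a)) \<in> transitions (m_transducer e)"
    using Cons.prems \<open>a \<in> A\<close> by (auto simp: m_transducer_def)
  ultimately show ?case using path_Cons by fastforce
qed

lemma realizes_m_output:
  "realizes_function A (m_transducer e) (m_final e) (\<lambda>u. rev (m_output e (map \<alpha> u)))"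
proof -
  have out: "u \<in> lists A \<and> v @ [m_final e q] = rev (m_output e (map \<alpha> u))"
    if "path (m_transducer e) 0 u v q" for u v q
    using m_transducer_path[OF that, of "[]"]
    by (simp add: m_output_map seq_output_def seq_run_def)
  show ?thesis
    unfolding realizes_function_def subsequential_realized_def
  proof (intro subset_antisym subsetI)
    fix x assume "x \<in> {(u, rev (m_output e (map \<alpha> u))) | u. u \<in> lists A}"
    then obtain u where u: "x = (u, rev (m_output e (map \<alpha> u)))" "u \<in> lists A" by blast
    obtain v q where "q < m_size e" "path (m_transducer e) 0 u v q"
      using m_transducer_total[OF u(2), of 0 e] by (auto simp: m_size_def)
    moreover from this have "x = (u, v @ [m_final e q])" using out u by simp
    ultimately show "x \<in> {(u, v @ [m_final e q]) | u v q. \<exists>p \<in> initial (m_transducer e).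
        q \<in> final (m_transducer e) \<and> path (m_transducer e) p u v q}"
      by (auto simp: m_transducer_def)
  next
    fix x assume "x \<in> {(u, v @ [m_final e q]) | u v q. \<exists>p \<in> initial (m_transducer e).
        q \<in> final (m_transducer e) \<and> path (m_transducer e) p u v q}"
    then obtain u v q where "x = (u, v @ [m_final e q])" "path (m_transducer e) 0 u v q"
      by (auto simp: m_transducer_def)
    then show "x \<in> {(u, rev (m_output e (map \<alpha> u))) | u. u \<in> lists A}" using out by auto
  qed
qed

lemma result_code_correct:
  "subsequential_code id \<alpha> id A {0..<Suc e} (m_transducer e) (m_final e) (result_code c e)"
proof -
  obtain as where as: "set as = A" "component c 0 = map \<alpha> as"
    "nth0 (list_decode c) 0 = list_encode (map \<alpha> as)" by (rule code_lists)
  define ds where "ds = concat (map (\<lambda>p. map (\<lambda>a. (p, ([a], [m_out e p (\<alpha> a)]), m_next e p (\<alpha> a))) as)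
    [0..<m_size e])"
  have "set ds = transitions (m_transducer e)"
    using as(1) by (auto simp: ds_def m_transducer_def)
  moreover have "map (transition_code id \<alpha> id) ds = concat (map (\<lambda>p. map (\<lambda>a. list_encode
      [p, list_encode [a], list_encode [m_out e p a], m_next e p a]) (component c 0)) [0..<m_size e])"
    unfolding ds_def as(2) map_concat map_map comp_def transition_code_def by simp
  ultimately have D: "lists_set (transition_code id \<alpha> id) (transitions (m_transducer e))
      (list_encode (concat (map (\<lambda>p. map (\<lambda>a. list_encode
      [p, list_encode [a], list_encode [m_out e p a], m_next e p a]) (component c 0)) [0..<m_size e])))"
    unfolding lists_set_def by metis
  have upt: "lists_set id {0..<m} (list_encode [0..<m])" for m
    unfolding lists_set_def by (intro exI[of _ "[0..<m]"]) simp
  have A: "lists_set \<alpha> A (nth0 (list_decode c) 0)" unfolding lists_set_def as(3) using as(1) by blast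
  have Q: "lists_set id (states (m_transducer e)) (list_encode [0..<m_size e])"
    "lists_set id (final (m_transducer e)) (list_encode [0..<m_size e])"
    by (simp_all add: m_transducer_def upt)
  have I: "lists_set id (initial (m_transducer e)) (list_encode [0])"
    unfolding lists_set_def m_transducer_def by (intro exI[of _ "[0]"]) simp
  have F: "lists_set (\<lambda>q. prod_encode (id q, id (m_final e q))) (final (m_transducer e))
      (list_encode (map (\<lambda>p. prod_encode (p, m_final e p)) [0..<m_size e]))"
    unfolding lists_set_def m_transducer_def by (intro exI[of _ "[0..<m_size e]"]) simp
  show ?thesis
    unfolding subsequential_code_def transducer_code_def result_code_def
    by (rule exI conjI inj_\<alpha> inj_on_id refl A Q D I F upt)+
qed

text \<open>This is where the hypothesis on the index enters: some machine has the right kernel on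
  all words, so its code passes the test, and the search halts.\<close>

lemma construction_exists:
  assumes "equiv (lists A) (realized T)"
    and "relative_index (lists A) (syntactic_congruence A (realized T))
      ((prefix_closure A (realized T))\<^sup>+) < \<infinity>"
  shows "\<exists>e. kernel_test c e"
proof -
  from subsequential_machine_exists[OF finite_alphabet assms(1) lp assms(2)
      residuals_bound(1)[unfolded residuals_def]]
  obtain n nx ot ft where n: "0 < n" "\<forall>p a. nx p a < n" and ker: "\<forall>u \<in> lists A. \<forall>v \<in> lists A.
      seq_output nx ot ft u = seq_output nx ot ft v \<longleftrightarrow> (u, v) \<in> realized T"
    by (elim exE conjE)
  obtain e where e: "\<forall>u \<in> lists A. m_output e (map \<alpha> u) = seq_output nx ot ft u"
    using ex_machine_code[where nx = nx, OF finite_alphabet inj_\<alpha> n(1)] n(2) by metis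
  have "kernel_test c e" unfolding kernel_test_iff using ker e by simp
  then show ?thesis by blast
qed

end

theorem theorem9:
  shows "\<exists>construction :: recfn.
    \<forall>(A :: 'a set) (R :: ('a list \<times> 'a list) set) (T :: ('q, 'a, 'a) transducer)
      (\<kappa> :: 'q \<Rightarrow> nat) (\<alpha> :: 'a \<Rightarrow> nat) (c :: nat).
      finite A \<and>
      finite_transducer A A T \<and> realized T = R \<and> transducer_code \<kappa> \<alpha> \<alpha> A A T c \<and>
      length_preserving R \<and> equiv (lists A) R \<and>
      relative_index (lists A) (syntactic_congruence A R) ((prefix_closure A R)\<^sup>+) < \<infinity>
      \<longrightarrow>
      (\<exists>(B :: nat set) (T' :: (nat, 'a, nat) transducer) (t :: nat \<Rightarrow> nat)
         (f :: 'a list \<Rightarrow> nat list) (d :: nat).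
         computes construction [c] d \<and> subsequential_code id \<alpha> id A B T' t d \<and>
         subsequential_transducer A B T' t \<and> letter_to_letter T' \<and>
         realizes_function A T' t f \<and> kernel_on A f = R)"
proof -
  \<comment> \<open>The program is obtained before the transducer and its code are fixed.\<close>
  obtain r where r: "\<And>c. \<exists>e. kernel_test c e \<Longrightarrow>
      \<exists>e. kernel_test c e \<and> computes r [c] (result_code c e)"
    using computes_search[OF cb_kernel_test cn_result_code] by metis
  show ?thesis
  proof (intro exI[of _ r] allI impI)
    fix A :: "'a set" and R and T :: "('q, 'a, 'a) transducer" and \<kappa> \<alpha> c
    assume *: "finite A \<and> finite_transducer A A T \<and> realized T = R \<and> transducer_code \<kappa> \<alpha> \<alpha> A A T c \<and>
      length_preserving R \<and> equiv (lists A) R \<and>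
      relative_index (lists A) (syntactic_congruence A R) ((prefix_closure A R)\<^sup>+) < \<infinity>"
    then interpret coded_transducer A T \<kappa> \<alpha> c
      by unfold_locales auto
    have R: "R = realized T" using * by simp
    obtain e where e: "kernel_test c e" "computes r [c] (result_code c e)"
      using r construction_exists * by metis
    have "R \<subseteq> lists A \<times> lists A" using * by (simp add: equiv_def)
    \<comment> \<open>Whatever machine the search finds has the right kernel on all words by
      \<open>kernel_test_correct\<close>; \<open>rev\<close> is injective and does not change the
      kernel.\<close>
    then have "kernel_on A (\<lambda>u. rev (m_output e (map \<alpha> u))) = R"
      using kernel_test_correct[OF e(1)] unfolding kernel_on_def R by fast
    then show "\<exists>B T' t f d. computes r [c] d \<and> subsequential_code id \<alpha> id A B T' t d \<and>
         subsequential_transducer A B T' t \<and> letter_to_letter T' \<and>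
         realizes_function A T' t f \<and> kernel_on A f = R"
      using e(2) result_code_correct subsequential_m_transducer letter_to_letter_m_transducer
        realizes_m_output by blast
  qed
qed

end
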